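(* Let $a,b\in\mathbb{R}$ and $q\in\mathbb{C}$. (1) Let $L$ be the differential operator on $\mathbb{T}^1\times\mathbb{R}$ given by $L=\partial_t+(a+ib)\partial_x+q$. Then $L$ is Schwartz globally hypoelliptic if and only if one of the following holds: - $b\neq0$ and $a\frac{\mathrm{Re}(q)}{b}+\mathrm{Im}(q)\notin\mathbb{Z}$; or - $b=0$ and $\mathrm{Re}(q)\neq0$; or - $b=\mathrm{Re}(q)=0=a$ and $\mathrm{Im}(q)\notin\mathbb{Z}$. (2) Let $\tilde{L}$ be the differential operator on $\mathbb{T}^1\times\mathbb{R}$ given by $\tilde{L}=(a+ib)\partial_t+\partial_x+q$. Then $\tilde{L}$ is Schwartz globally hypoelliptic if and only if one of the following holds: - $b\neq0$ and $\frac{\mathrm{Re}(q)}{b}\notin\mathbb{Z}$; or - $b=0$ and $\mathrm{Re}(q)\neq0$.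
   Context: $\mathbb{T}^1=\mathbb{R}/2\pi\mathbb{Z}$, with variables $(t,x)\in\mathbb{T}^1\times\mathbb{R}$. $\mathcal{S}(\mathbb{T}^1\times\mathbb{R})$ is the Fréchet space of all complex-valued $f\in C^\infty(\mathbb{T}^1\times\mathbb{R})$ such that $\|f\|_{\alpha,\beta,\gamma}:=\sup_{(t,x)}|x^\gamma\partial_t^\alpha\partial_x^\beta f(t,x)|<+\infty$ for all nonnegative integers $\alpha,\beta,\gamma$, with seminorms $p_N(f):=\sum_{\alpha+\beta+\gamma\leq N}\|f\|_{\alpha,\beta,\gamma}$. $\mathcal{S}'(\mathbb{T}^1\times\mathbb{R})$ is its topological dual; functions of at most polynomial growth in $x$, uniformly in $t$, are identified with elements of $\mathcal{S}'(\mathbb{T}^1\times\mathbb{R})$ through $f\mapsto\int uf\,dt\,dx$, and differential operators act on $\mathcal{S}'$ in the usual distributional (dual) sense. A differential operator $L:\mathcal{S}'(\mathbb{T}^1\times\mathbb{R})\to\mathcal{S}'(\mathbb{T}^1\times\mathbb{R})$ is called Schwartz globally hypoelliptic (SGH) if whenever $u\in\mathcal{S}'(\mathbb{T}^1\times\mathbb{R})$ and $Lu\in\mathcal{S}(\mathbb{T}^1\times\mathbb{R})$, then $u\in\mathcal{S}(\mathbb{T}^1\times\mathbb{R})$. *)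

theory Defs
  imports "HOL-Analysis.Analysis"
begin

text \<open>
  A function on \<open>T\<^sup>1 \<times> \<real>\<close>, where \<open>T\<^sup>1 = \<real> / 2\<pi>\<int>\<close>, is represented by its lift to
  \<open>\<real> \<times> \<real>\<close>, which is \<open>2\<pi>\<close>-periodic in the first variable \<open>t\<close>.
\<close>

type_synonym cfun = "real \<times> real \<Rightarrow> complex"

definition periodic_t :: "cfun \<Rightarrow> bool" where
  "periodic_t f \<longleftrightarrow> (\<forall>t x. f (t + 2 * pi, x) = f (t, x))"

definition partial_t :: "cfun \<Rightarrow> cfun" where
  "partial_t f = (\<lambda>(t, x). vector_derivative (\<lambda>s. f (s, x)) (at t))"

definition partial_x :: "cfun \<Rightarrow> cfun" where
  "partial_x f = (\<lambda>(t, x). vector_derivative (\<lambda>y. f (t, y)) (at x))"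

primrec Ck :: "nat \<Rightarrow> cfun \<Rightarrow> bool" where
  "Ck 0 f \<longleftrightarrow> continuous_on UNIV f"
| "Ck (Suc k) f \<longleftrightarrow> continuous_on UNIV f \<and>
     (\<forall>t x. (\<lambda>s. f (s, x)) differentiable (at t)) \<and>
     (\<forall>t x. (\<lambda>y. f (t, y)) differentiable (at x)) \<and>
     Ck k (partial_t f) \<and> Ck k (partial_x f)"

definition smooth :: "cfun \<Rightarrow> bool" where
  "smooth f \<longleftrightarrow> (\<forall>k. Ck k f)"

definition weighted_deriv :: "nat \<Rightarrow> nat \<Rightarrow> nat \<Rightarrow> cfun \<Rightarrow> real \<times> real \<Rightarrow> real" where
  "weighted_deriv \<alpha> \<beta> \<gamma> f =
     (\<lambda>(t, x). norm (of_real x ^ \<gamma> * (partial_t ^^ \<alpha>) ((partial_x ^^ \<beta>) f) (t, x)))"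

definition schwartz :: "cfun set" where
  "schwartz = {f. periodic_t f \<and> smooth f \<and>
                  (\<forall>\<alpha> \<beta> \<gamma>. bdd_above (range (weighted_deriv \<alpha> \<beta> \<gamma> f)))}"

definition schwartz_norm :: "nat \<Rightarrow> nat \<Rightarrow> nat \<Rightarrow> cfun \<Rightarrow> real" where
  "schwartz_norm \<alpha> \<beta> \<gamma> f = (SUP z. weighted_deriv \<alpha> \<beta> \<gamma> f z)"

definition schwartz_seminorm :: "nat \<Rightarrow> cfun \<Rightarrow> real" where
  "schwartz_seminorm N f =
     (\<Sum>(\<alpha>, \<beta>, \<gamma>)\<in>{(\<alpha>, \<beta>, \<gamma>). \<alpha> + \<beta> + \<gamma> \<le> N}. schwartz_norm \<alpha> \<beta> \<gamma> f)"

definition schwartz_topology :: "cfun topology" where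
  "schwartz_topology = topology_generated_by
     {{g \<in> schwartz. schwartz_seminorm N (\<lambda>z. g z - f z) < \<epsilon>} | f N \<epsilon>. f \<in> schwartz \<and> 0 < \<epsilon>}"

text \<open>
  Functionals are total on \<^typ>\<open>cfun\<close>; only their values on \<^const>\<open>schwartz\<close> are meaningful, and
  every notion below depends on those values only.
\<close>

type_synonym functional = "cfun \<Rightarrow> complex"

definition tempered_distributions :: "functional set" where
  "tempered_distributions = {u.
     (\<forall>f\<in>schwartz. \<forall>g\<in>schwartz. u (\<lambda>z. f z + g z) = u f + u g) \<and>
     (\<forall>c. \<forall>f\<in>schwartz. u (\<lambda>z. c * f z) = c * u f) \<and>
     continuous_map schwartz_topology euclidean u}"

text \<open>The integral is over one period in \<open>t\<close>, i.e. over \<open>T\<^sup>1 \<times> \<real>\<close>.\<close>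

definition dist_of_fun :: "cfun \<Rightarrow> functional" where
  "dist_of_fun f = (\<lambda>\<phi>. LINT z:({0..2 * pi} \<times> UNIV)|lborel. f z * \<phi> z)"

definition is_schwartz :: "functional \<Rightarrow> bool" where
  "is_schwartz u \<longleftrightarrow> (\<exists>f\<in>schwartz. \<forall>\<phi>\<in>schwartz. u \<phi> = dist_of_fun f \<phi>)"

definition dist_partial_t :: "functional \<Rightarrow> functional" where
  "dist_partial_t u = (\<lambda>\<phi>. - u (partial_t \<phi>))"

definition dist_partial_x :: "functional \<Rightarrow> functional" where
  "dist_partial_x u = (\<lambda>\<phi>. - u (partial_x \<phi>))"

text \<open>The operator \<open>c\<^sub>t \<partial>\<^sub>t + c\<^sub>x \<partial>\<^sub>x + q\<close> acting on distributions.\<close>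

definition first_order_op :: "complex \<Rightarrow> complex \<Rightarrow> complex \<Rightarrow> functional \<Rightarrow> functional" where
  "first_order_op c\<^sub>t c\<^sub>x q u =
     (\<lambda>\<phi>. c\<^sub>t * dist_partial_t u \<phi> + c\<^sub>x * dist_partial_x u \<phi> + q * u \<phi>)"

definition schwartz_globally_hypoelliptic :: "(functional \<Rightarrow> functional) \<Rightarrow> bool" where
  "schwartz_globally_hypoelliptic P \<longleftrightarrow>
     (\<forall>u\<in>tempered_distributions. is_schwartz (P u) \<longrightarrow> is_schwartz u)"

end

theory Submission
  imports Defs "HOL-Probability.Sinc_Integral"
begin

text \<open>
  The operator \<open>L = c\<^sub>t \<partial>\<^sub>t + c\<^sub>x \<partial>\<^sub>x + q\<close> acts on the plane wave \<open>e\<^bsup>i(kt + \<xi>x)\<^esup>\<close>, with \<open>k\<close> an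
  integer and \<open>\<xi>\<close> real, as multiplication by the symbol \<open>i k c\<^sub>t + i \<xi> c\<^sub>x + q\<close>. Separating real
  and imaginary parts shows that each condition in the theorem says exactly that the symbol has
  no zero.

  If the symbol vanishes at \<open>(k, \<xi>)\<close>, the plane wave is a tempered distribution \<open>u\<close> with \<open>L u = 0\<close>
  (\<open>not_hypoelliptic_if_symbol_zero\<close>). It is not a Schwartz function: tested against the conjugate
  wave times a Gaussian centred at \<open>x = n\<close> it returns a value whose modulus is positive and does
  not depend on \<open>n\<close>, whereas a Schwartz function returns values that tend to \<open>0\<close> as \<open>n\<close> grows
  (\<open>plane_wave_not_schwartz\<close>).

  If the symbol has no zero, no regularity theory of distributions is needed. It suffices that
  \<open>L\<close> and its transpose \<open>L\<^sup>t = - c\<^sub>t \<partial>\<^sub>t - c\<^sub>x \<partial>\<^sub>x + q\<close> both map the Schwartz space onto itself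
  (\<open>hypoelliptic_if_solvable\<close>): when \<open>L u = f\<close> is Schwartz, write \<open>f = L g\<close> and any test function
  as \<open>\<phi> = L\<^sup>t \<psi>\<close>; then \<open>u(\<phi>) = (L u)(\<psi>) = \<integral> (L g) \<psi> = \<integral> g \<phi>\<close>, that is, \<open>u = g\<close>.

  The equation \<open>L g = f\<close> is solved one Fourier mode in \<open>t\<close> at a time. Let \<open>P\<^sub>k f\<close> be the component
  of \<open>f\<close> proportional to \<open>e\<^bsup>ikt\<^esup>\<close>. On it \<open>L\<close> becomes the ordinary differential operator
  \<open>c\<^sub>x (\<partial>\<^sub>x + \<mu>\<^sub>k)\<close> with \<open>\<mu>\<^sub>k = (i k c\<^sub>t + q) / c\<^sub>x\<close>. Absence of real zeros means \<open>Re \<mu>\<^sub>k \<noteq> 0\<close>,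
      and here
  \<open>\<bar>Re \<mu>\<^sub>k\<bar>\<close> is even bounded below uniformly in \<open>k\<close>, so that \<open>\<partial>\<^sub>x + \<mu>\<^sub>k\<close> is inverted by
  convolution with an exponential on a half line, with bounds that do not depend on \<open>k\<close>
  (\<open>half_line_solves\<close>, \<open>schwartz_norm_half_line\<close>). If \<open>c\<^sub>x = 0\<close>, one simply divides by the symbol.
  The seminorms of \<open>P\<^sub>k f\<close> are \<open>O(1 / (1 + k\<^sup>2))\<close> because \<open>\<partial>\<^sub>t\<^sup>2 P\<^sub>k f = - k\<^sup>2 P\<^sub>k f\<close>,
      so the solutions
  add up to a Schwartz function \<open>g\<close> with \<open>L g = \<Sum>\<^sub>k P\<^sub>k f\<close>, and the last sum is \<open>f\<close> by Fourier
  inversion (\<open>fourier_inversion\<close>, \<open>solvable_of_modes\<close>).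

  Projections, half-line solutions and infinite sums are all integrals of families of Schwartz
  functions with integrable seminorms, so a single theorem on such integrals
  (\<open>schwartz_integral\<close>) carries the analysis.
\<close>

section \<open>Calculus of Schwartz functions on the cylinder\<close>

lemma Ck_imp_continuous_on: "Ck k f \<Longrightarrow> continuous_on UNIV f"
  by (cases k) auto

lemma smooth_continuous_on: "smooth f \<Longrightarrow> continuous_on UNIV f"
  using Ck_imp_continuous_on unfolding smooth_def by blast

lemma smooth_partial_t: "smooth f \<Longrightarrow> smooth (partial_t f)"
  unfolding smooth_def by (metis Ck.simps(2))

lemma smooth_partial_x: "smooth f \<Longrightarrow> smooth (partial_x f)"
  unfolding smooth_def by (metis Ck.simps(2))

lemma smooth_deriv_t:
  assumes "smooth f"
  shows "((\<lambda>s. f (s, x)) has_vector_derivative partial_t f (t, x)) (at t)"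
proof -
  have "Ck (Suc 0) f" using assms unfolding smooth_def by blast
  then have "(\<lambda>s. f (s, x)) differentiable (at t)" by auto
  then show ?thesis by (simp add: partial_t_def vector_derivative_works)
qed

lemma smooth_deriv_x:
  assumes "smooth f"
  shows "((\<lambda>y. f (t, y)) has_vector_derivative partial_x f (t, x)) (at x)"
proof -
  have "Ck (Suc 0) f" using assms unfolding smooth_def by blast
  then have "(\<lambda>y. f (t, y)) differentiable (at x)" by auto
  then show ?thesis by (simp add: partial_x_def vector_derivative_works)
qed

lemma continuous_on_slice_t:
  "continuous_on UNIV f \<Longrightarrow> continuous_on S (\<lambda>s. f (s, x))" for f :: cfun
  by (rule continuous_on_compose2[of UNIV f]) (auto intro!: continuous_intros)

lemma continuous_on_slice_x:
  "continuous_on UNIV f \<Longrightarrow> continuous_on S (\<lambda>y. f (t, y))" for f :: cfun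
  by (rule continuous_on_compose2[of UNIV f]) (auto intro!: continuous_intros)

text \<open>Symmetry of second derivatives, by differentiating
  \<open>f(s, y) = f(s, x - 1) + \<integral> \<partial>\<^sub>x f(s, r) dr\<close> under the integral sign in \<open>s\<close> and then in \<open>y\<close>.\<close>

lemma partial_t_partial_x_commute:
  assumes f: "smooth f"
  shows "partial_x (partial_t f) = partial_t (partial_x f)"
proof -
  have "partial_x (partial_t f) (t, x) = partial_t (partial_x f) (t, x)" for t x
  proof -
    define p where "p = partial_t (partial_x f)"
    have cp: "continuous_on UNIV p" and cfx: "continuous_on UNIV (partial_x f)"
      unfolding p_def using f smooth_continuous_on smooth_partial_t smooth_partial_x by blast+
    \<comment> \<open>Any base point to the left of \<open>x\<close> would do; it has to be fixed while \<open>y\<close> varies around \<open>x\<close>.\<close>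
    have ftc: "f (s, y) = f (s, x - 1) + integral {x - 1..y} (\<lambda>r. partial_x f (s, r))"
      if "y \<ge> x - 1" for s y
    proof -
      have "((\<lambda>r. partial_x f (s, r)) has_integral (f (s, y) - f (s, x - 1))) {x - 1..y}"
        using that
        by (intro fundamental_theorem_of_calculus)
          (auto intro!: has_vector_derivative_at_within smooth_deriv_x f)
      from integral_unique[OF this] show ?thesis by simp
    qed
    have ft: "partial_t f (t, y) = partial_t f (t, x - 1) + integral {x - 1..y} (\<lambda>r. p (t, r))"
      if y: "y \<ge> x - 1" for y
    proof -
      have "((\<lambda>s. integral (cbox (x - 1) y) (\<lambda>r. partial_x f (s, r))) has_vector_derivative
              integral (cbox (x - 1) y) (\<lambda>r. p (t, r))) (at t within UNIV)"
      proof (rule leibniz_rule_vector_derivative)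
        show "((\<lambda>s. partial_x f (s, r)) has_vector_derivative p (s, r)) (at s within UNIV)" for s r
          unfolding p_def using smooth_deriv_t[OF smooth_partial_x[OF f]] by simp
        show "(\<lambda>r. partial_x f (s, r)) integrable_on cbox (x - 1) y" for s
          by (intro integrable_continuous continuous_on_slice_x cfx)
        show "continuous_on (UNIV \<times> cbox (x - 1) y) (\<lambda>(s, r). p (s, r))"
          using continuous_on_subset[OF cp] by (auto simp: case_prod_beta)
      qed auto
      then have "((\<lambda>s. f (s, x - 1) + integral {x - 1..y} (\<lambda>r. partial_x f (s, r)))
              has_vector_derivative
              partial_t f (t, x - 1) + integral {x - 1..y} (\<lambda>r. p (t, r))) (at t)"
        by (intro has_vector_derivative_add smooth_deriv_t f) simp
      then have "((\<lambda>s. f (s, y)) has_vector_derivative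
              partial_t f (t, x - 1) + integral {x - 1..y} (\<lambda>r. p (t, r))) (at t)"
        by (subst ftc[OF y])
      then show ?thesis using smooth_deriv_t[OF f, of y t] vector_derivative_unique_at by blast
    qed
    have "((\<lambda>y. integral {x - 1..y} (\<lambda>r. p (t, r))) has_vector_derivative p (t, x))
            (at x within {x - 1..x + 1})"
      by (rule integral_has_vector_derivative) (auto intro!: continuous_on_slice_x cp)
    then have "((\<lambda>y. integral {x - 1..y} (\<lambda>r. p (t, r))) has_vector_derivative p (t, x)) (at x)"
      using at_within_interior[of x "{x - 1..x + 1}"] by simp
    then have d: "((\<lambda>y. partial_t f (t, x - 1) + integral {x - 1..y} (\<lambda>r. p (t, r)))
            has_vector_derivative p (t, x)) (at x)"
      using has_vector_derivative_add[OF has_vector_derivative_const] by force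
    have "((\<lambda>y. partial_t f (t, y)) has_vector_derivative p (t, x)) (at x)"
      by (rule has_vector_derivative_transform_within_open[OF d, of "{x - 1<..}"])
        (auto intro!: ft[symmetric])
    then show ?thesis
      unfolding p_def
      using smooth_deriv_x[OF smooth_partial_t[OF f], of t x] vector_derivative_unique_at by blast
  qed
  then show ?thesis by auto
qed

text \<open>The derivatives are taken in the order that the seminorms prescribe. By symmetry, a
  further \<open>\<partial>\<^sub>t\<close> or \<open>\<partial>\<^sub>x\<close> of a smooth function only raises the corresponding index.\<close>

definition mixed :: "nat \<Rightarrow> nat \<Rightarrow> cfun \<Rightarrow> cfun" where
  "mixed \<alpha> \<beta> f = (partial_t ^^ \<alpha>) ((partial_x ^^ \<beta>) f)"

lemma mixed_0 [simp]: "mixed 0 0 f = f"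
  by (simp add: mixed_def)

lemma smooth_partial_t_power: "smooth f \<Longrightarrow> smooth ((partial_t ^^ \<alpha>) f)"
  by (induction \<alpha>) (auto intro: smooth_partial_t)

lemma smooth_partial_x_power: "smooth f \<Longrightarrow> smooth ((partial_x ^^ \<alpha>) f)"
  by (induction \<alpha>) (auto intro: smooth_partial_x)

lemma smooth_mixed: "smooth f \<Longrightarrow> smooth (mixed \<alpha> \<beta> f)"
  unfolding mixed_def by (intro smooth_partial_t_power smooth_partial_x_power)

lemma partial_t_mixed: "partial_t (mixed \<alpha> \<beta> f) = mixed (Suc \<alpha>) \<beta> f"
  by (simp add: mixed_def)

lemma partial_x_partial_t_power:
  "smooth f \<Longrightarrow> partial_x ((partial_t ^^ \<alpha>) f) = (partial_t ^^ \<alpha>) (partial_x f)"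
  by (induction \<alpha>) (auto simp: partial_t_partial_x_commute smooth_partial_t_power)

lemma partial_x_mixed:
  assumes "smooth f"
  shows "partial_x (mixed \<alpha> \<beta> f) = mixed \<alpha> (Suc \<beta>) f"
  using partial_x_partial_t_power[OF smooth_partial_x_power[OF assms]] by (simp add: mixed_def)

lemma periodic_partial_t:
  assumes f: "smooth f" and p: "periodic_t f"
  shows "periodic_t (partial_t f)"
  unfolding periodic_t_def
proof (intro allI)
  fix t x
  have "((\<lambda>s. f (s, x)) \<circ> (\<lambda>s. s + 2 * pi) has_vector_derivative 1 *\<^sub>R partial_t f (t + 2 * pi,
      x)) (at t)"
    by (rule vector_diff_chain_at[OF _ smooth_deriv_t[OF f]]) (auto intro!: derivative_eq_intros)
  moreover have "(\<lambda>s. f (s, x)) \<circ> (\<lambda>s. s + 2 * pi) = (\<lambda>s. f (s, x))"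
    using p by (auto simp: periodic_t_def)
  ultimately have "((\<lambda>s. f (s, x)) has_vector_derivative partial_t f (t + 2 * pi, x)) (at t)"
    by simp
  then show "partial_t f (t + 2 * pi, x) = partial_t f (t, x)"
    using smooth_deriv_t[OF f] vector_derivative_unique_at by blast
qed

lemma periodic_partial_x: "periodic_t f \<Longrightarrow> periodic_t (partial_x f)"
  unfolding periodic_t_def partial_x_def by simp

lemma periodic_mixed:
  assumes f: "smooth f" and p: "periodic_t f"
  shows "periodic_t (mixed \<alpha> \<beta> f)"
proof -
  have 1: "periodic_t ((partial_x ^^ \<beta>) f)"
    by (induction \<beta>) (auto intro: periodic_partial_x p)
  have 2: "periodic_t ((partial_t ^^ \<alpha>) g)" if "smooth g" "periodic_t g" for g
    using that by (induction \<alpha>) (auto intro: periodic_partial_t smooth_partial_t_power)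
  show ?thesis unfolding mixed_def using 1 2 smooth_partial_x_power[OF f] by blast
qed

lemma weighted_deriv_eq:
  "weighted_deriv \<alpha> \<beta> \<gamma> f (t, x) = \<bar>x\<bar> ^ \<gamma> * norm (mixed \<alpha> \<beta> f (t, x))"
  by (simp add: weighted_deriv_def mixed_def norm_mult norm_power)

lemma schwartz_smooth: "f \<in> schwartz \<Longrightarrow> smooth f"
  and schwartz_periodic: "f \<in> schwartz \<Longrightarrow> periodic_t f"
  by (auto simp: schwartz_def)

lemma schwartz_mixed_deriv_t:
  "f \<in> schwartz \<Longrightarrow>
    ((\<lambda>s. mixed \<alpha> \<beta> f (s, x)) has_vector_derivative mixed (Suc \<alpha>) \<beta> f (t, x)) (at t)"
  using smooth_deriv_t[OF smooth_mixed[OF schwartz_smooth]] by (simp add: partial_t_mixed)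

lemma schwartz_mixed_deriv_x:
  "f \<in> schwartz \<Longrightarrow>
    ((\<lambda>y. mixed \<alpha> \<beta> f (t, y)) has_vector_derivative mixed \<alpha> (Suc \<beta>) f (t, x)) (at x)"
  using smooth_deriv_x[OF smooth_mixed[OF schwartz_smooth]]
  by (simp add: partial_x_mixed schwartz_smooth)

lemma schwartz_mixed_bound:
  assumes "f \<in> schwartz"
  shows "\<bar>x\<bar> ^ \<gamma> * norm (mixed \<alpha> \<beta> f (t, x)) \<le> schwartz_norm \<alpha> \<beta> \<gamma> f"
proof -
  have "bdd_above (range (weighted_deriv \<alpha> \<beta> \<gamma> f))" using assms by (auto simp: schwartz_def)
  then have "weighted_deriv \<alpha> \<beta> \<gamma> f (t, x) \<le> schwartz_norm \<alpha> \<beta> \<gamma> f"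
    unfolding schwartz_norm_def by (intro cSUP_upper) auto
  then show ?thesis by (simp add: weighted_deriv_eq)
qed

lemma schwartz_norm_nonneg: "f \<in> schwartz \<Longrightarrow> 0 \<le> schwartz_norm \<alpha> \<beta> \<gamma> f"
  by (rule order_trans[OF _ schwartz_mixed_bound[of f 0 \<gamma> \<alpha> \<beta> 0]]) auto

lemma schwartz_norm_leI:
  assumes "\<And>t x. \<bar>x\<bar> ^ \<gamma> * norm (mixed \<alpha> \<beta> f (t, x)) \<le> C"
  shows "schwartz_norm \<alpha> \<beta> \<gamma> f \<le> C"
  unfolding schwartz_norm_def by (rule cSUP_least) (use assms in \<open>auto simp: weighted_deriv_eq\<close>)

lemma schwartz_mixed_continuous: "f \<in> schwartz \<Longrightarrow> continuous_on UNIV (mixed \<alpha> \<beta> f)"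
  by (intro smooth_continuous_on smooth_mixed schwartz_smooth)

text \<open>Existence of both partial derivatives does not imply continuity, but bounded ones make
  the function Lipschitz in each variable separately, and hence continuous.\<close>

lemma continuous_on_bounded_partials:
  fixes f :: cfun
  assumes t: "\<And>t x. ((\<lambda>s. f (s, x)) has_vector_derivative f1 (t, x)) (at t)"
    and x: "\<And>t x. ((\<lambda>y. f (t, y)) has_vector_derivative f2 (t, x)) (at x)"
    and b1: "\<And>z. norm (f1 z) \<le> C1" and b2: "\<And>z. norm (f2 z) \<le> C2"
  shows "continuous_on UNIV f"
proof -
  have lt: "norm (f (s, x) - f (t, x)) \<le> C1 * norm (s - t)" for s t x
    by (rule differentiable_bound[where S = UNIV and f' = "\<lambda>t h. h *\<^sub>R f1 (t, x)"])
       (use t b1 in \<open>auto simp: has_vector_derivative_def mult.commute[of C1]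
          intro!: onorm_bound mult_right_mono order_trans[OF norm_ge_zero b1] mult_left_mono\<close>)
  have lx: "norm (f (t, y) - f (t, x)) \<le> C2 * norm (y - x)" for y t x
    by (rule differentiable_bound[where S = UNIV and f' = "\<lambda>x h. h *\<^sub>R f2 (t, x)"])
       (use x b2 in \<open>auto simp: has_vector_derivative_def mult.commute[of C2]
          intro!: onorm_bound mult_right_mono order_trans[OF norm_ge_zero b2] mult_left_mono\<close>)
  have "((\<lambda>w. f w - f z) \<longlongrightarrow> 0) (at z)" for z
  proof (rule Lim_null_comparison)
    show "\<forall>\<^sub>F w in at z. norm (f w - f z) \<le>
        C1 * norm (fst w - fst z) + C2 * norm (snd w - snd z)"
    proof (rule always_eventually, rule allI)
      fix w
      have "f w - f z = (f (fst w, snd w) - f (fst z, snd w)) + (f (fst z, snd w) - f (fst z,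
          snd z))"
        by simp
      also have "norm \<dots> \<le> C1 * norm (fst w - fst z) + C2 * norm (snd w - snd z)"
        by (intro norm_triangle_mono lt lx)
      finally show "norm (f w - f z) \<le> C1 * norm (fst w - fst z) + C2 * norm (snd w - snd z)" .
    qed
    show "((\<lambda>w. C1 * norm (fst w - fst z) + C2 * norm (snd w - snd z)) \<longlongrightarrow> 0) (at z)"
      by (auto intro!: tendsto_eq_intros)
  qed
  then show ?thesis by (auto simp: continuous_on_def LIM_zero_iff)
qed

text \<open>The way in which all Schwartz functions below are produced: it suffices to exhibit
  candidates \<open>d \<alpha> \<beta>\<close> for all mixed derivatives, linked by one differentiation in each
  variable, with weighted bounds. Continuity comes for free because the next derivatives are
  bounded.\<close>

lemma schwartz_family:
  fixes d :: "nat \<Rightarrow> nat \<Rightarrow> cfun"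
  assumes per: "periodic_t (d 0 0)"
    and dt: "\<And>\<alpha> \<beta> t x. ((\<lambda>s. d \<alpha> \<beta> (s, x)) has_vector_derivative d (Suc \<alpha>) \<beta> (t, x)) (at t)"
    and dx: "\<And>\<alpha> \<beta> t x. ((\<lambda>y. d \<alpha> \<beta> (t, y)) has_vector_derivative d \<alpha> (Suc \<beta>) (t, x)) (at x)"
    and bd: "\<And>\<alpha> \<beta> \<gamma>. \<exists>C. \<forall>t x. \<bar>x\<bar> ^ \<gamma> * norm (d \<alpha> \<beta> (t, x)) \<le> C"
  shows "d 0 0 \<in> schwartz" and "mixed \<alpha> \<beta> (d 0 0) = d \<alpha> \<beta>"
proof -
  have pt: "partial_t (d \<alpha> \<beta>) = d (Suc \<alpha>) \<beta>" for \<alpha> \<beta>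
    unfolding partial_t_def using vector_derivative_at[OF dt] by auto
  have px: "partial_x (d \<alpha> \<beta>) = d \<alpha> (Suc \<beta>)" for \<alpha> \<beta>
    unfolding partial_x_def using vector_derivative_at[OF dx] by auto
  have bd0: "\<exists>C. \<forall>z. norm (d \<alpha> \<beta> z) \<le> C" for \<alpha> \<beta>
    using bd[of 0 \<alpha> \<beta>] by auto
  have cont: "continuous_on UNIV (d \<alpha> \<beta>)" for \<alpha> \<beta>
  proof -
    obtain C1 C2 where "\<And>z. norm (d (Suc \<alpha>) \<beta> z) \<le> C1" "\<And>z. norm (d \<alpha> (Suc \<beta>) z) \<le> C2"
      using bd0 by metis
    then show ?thesis using continuous_on_bounded_partials[OF dt dx] by blast
  qed
  have "Ck k (d \<alpha> \<beta>)" for k \<alpha> \<beta>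
    by (induction k arbitrary: \<alpha> \<beta>)
      (auto simp: cont pt px intro!: differentiableI_vector dt dx)
  then have "smooth (d 0 0)" by (simp add: smooth_def)
  have "(partial_x ^^ \<beta>) (d 0 0) = d 0 \<beta>" for \<beta>
    by (induction \<beta>) (auto simp: px)
  moreover have "(partial_t ^^ \<alpha>) (d 0 \<beta>) = d \<alpha> \<beta>" for \<alpha> \<beta>
    by (induction \<alpha>) (auto simp: pt)
  ultimately show m: "mixed \<alpha> \<beta> (d 0 0) = d \<alpha> \<beta>" for \<alpha> \<beta>
    by (simp add: mixed_def)
  have "bdd_above (range (weighted_deriv \<alpha> \<beta> \<gamma> (d 0 0)))" for \<alpha> \<beta> \<gamma>
    using bd[of \<gamma> \<alpha> \<beta>] by (auto simp: bdd_above_def weighted_deriv_eq m)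
  with \<open>smooth (d 0 0)\<close> per show "d 0 0 \<in> schwartz" by (simp add: schwartz_def)
qed

lemma schwartz_add:
  assumes f: "f \<in> schwartz" and g: "g \<in> schwartz"
  shows "(\<lambda>z. f z + g z) \<in> schwartz"
proof -
  define d where "d \<alpha> \<beta> = (\<lambda>z. mixed \<alpha> \<beta> f z + mixed \<alpha> \<beta> g z)" for \<alpha> \<beta>
  have 1: "periodic_t (d 0 0)"
    using schwartz_periodic[OF f] schwartz_periodic[OF g] by (simp add: periodic_t_def d_def)
  have 2: "((\<lambda>s. d \<alpha> \<beta> (s, x)) has_vector_derivative d (Suc \<alpha>) \<beta> (t, x)) (at t)" for \<alpha> \<beta> t x
    unfolding d_def by (intro has_vector_derivative_add schwartz_mixed_deriv_t f g)
  have 3: "((\<lambda>y. d \<alpha> \<beta> (t, y)) has_vector_derivative d \<alpha> (Suc \<beta>) (t, x)) (at x)" for \<alpha> \<beta> t x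
    unfolding d_def by (intro has_vector_derivative_add schwartz_mixed_deriv_x f g)
  have 4: "\<exists>C. \<forall>t x. \<bar>x\<bar> ^ \<gamma> * norm (d \<alpha> \<beta> (t, x)) \<le> C" for \<alpha> \<beta> \<gamma>
  proof (intro exI allI)
    fix t x
    have "\<bar>x\<bar> ^ \<gamma> * norm (d \<alpha> \<beta> (t, x)) \<le>
        \<bar>x\<bar> ^ \<gamma> * norm (mixed \<alpha> \<beta> f (t, x)) + \<bar>x\<bar> ^ \<gamma> * norm (mixed \<alpha> \<beta> g (t, x))"
      unfolding d_def by (simp flip: distrib_left add: mult_left_mono norm_triangle_ineq)
    also have "\<dots> \<le> schwartz_norm \<alpha> \<beta> \<gamma> f + schwartz_norm \<alpha> \<beta> \<gamma> g"
      by (intro add_mono schwartz_mixed_bound f g)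
    finally show "\<bar>x\<bar> ^ \<gamma> * norm (d \<alpha> \<beta> (t, x)) \<le> schwartz_norm \<alpha> \<beta> \<gamma> f + schwartz_norm \<alpha> \<beta> \<gamma> g" .
  qed
  have "d 0 0 = (\<lambda>z. f z + g z)" by (simp add: d_def)
  with schwartz_family(1)[OF 1 2 3 4] show "(\<lambda>z. f z + g z) \<in> schwartz" by simp
qed

lemma
  assumes f: "f \<in> schwartz"
  shows schwartz_mult_left: "(\<lambda>z. c * f z) \<in> schwartz"
    and mixed_mult_left: "mixed \<alpha> \<beta> (\<lambda>z. c * f z) = (\<lambda>z. c * mixed \<alpha> \<beta> f z)"
proof -
  define d where "d \<alpha> \<beta> = (\<lambda>z. c * mixed \<alpha> \<beta> f z)" for \<alpha> \<beta>
  have 1: "periodic_t (d 0 0)"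
    using schwartz_periodic[OF f] by (simp add: periodic_t_def d_def)
  have 2: "((\<lambda>s. d \<alpha> \<beta> (s, x)) has_vector_derivative d (Suc \<alpha>) \<beta> (t, x)) (at t)" for \<alpha> \<beta> t x
    unfolding d_def by (intro has_vector_derivative_mult_right schwartz_mixed_deriv_t f)
  have 3: "((\<lambda>y. d \<alpha> \<beta> (t, y)) has_vector_derivative d \<alpha> (Suc \<beta>) (t, x)) (at x)" for \<alpha> \<beta> t x
    unfolding d_def by (intro has_vector_derivative_mult_right schwartz_mixed_deriv_x f)
  have 4: "\<exists>C. \<forall>t x. \<bar>x\<bar> ^ \<gamma> * norm (d \<alpha> \<beta> (t, x)) \<le> C" for \<alpha> \<beta> \<gamma>
  proof (intro exI allI)
    fix t x
    have "\<bar>x\<bar> ^ \<gamma> * norm (d \<alpha> \<beta> (t, x)) = norm c * (\<bar>x\<bar> ^ \<gamma> * norm (mixed \<alpha> \<beta> f (t, x)))"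
      unfolding d_def by (simp add: norm_mult)
    also have "\<dots> \<le> norm c * schwartz_norm \<alpha> \<beta> \<gamma> f"
      by (intro mult_left_mono schwartz_mixed_bound f) auto
    finally show "\<bar>x\<bar> ^ \<gamma> * norm (d \<alpha> \<beta> (t, x)) \<le> norm c * schwartz_norm \<alpha> \<beta> \<gamma> f" .
  qed
  have "d 0 0 = (\<lambda>z. c * f z)" by (simp add: d_def)
  with schwartz_family[OF 1 2 3 4]
  show "(\<lambda>z. c * f z) \<in> schwartz"
    "mixed \<alpha> \<beta> (\<lambda>z. c * f z) = (\<lambda>z. c * mixed \<alpha> \<beta> f z)"
    by (simp_all add: d_def)
qed

lemma schwartz_diff:
  "f \<in> schwartz \<Longrightarrow> g \<in> schwartz \<Longrightarrow> (\<lambda>z. f z - g z) \<in> schwartz"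
  using schwartz_add[OF _ schwartz_mult_left[of g "-1"]] by simp

lemma
  assumes f: "f \<in> schwartz"
  shows schwartz_partial_t: "partial_t f \<in> schwartz"
    and schwartz_partial_x: "partial_x f \<in> schwartz"
    and mixed_partial_t: "mixed \<alpha> \<beta> (partial_t f) = mixed (Suc \<alpha>) \<beta> f"
proof -
  have bd: "\<exists>C. \<forall>t x. \<bar>x\<bar> ^ \<gamma> * norm (mixed \<alpha> \<beta> f (t, x)) \<le> C" for \<alpha> \<beta> \<gamma>
    using schwartz_mixed_bound[OF f] by blast
  have eq: "partial_t f = mixed (Suc 0) 0 f" "partial_x f = mixed 0 (Suc 0) f"
    by (simp_all add: mixed_def)
  note per = periodic_mixed[OF schwartz_smooth[OF f] schwartz_periodic[OF f]]
  note dt = schwartz_mixed_deriv_t[OF f] and dx = schwartz_mixed_deriv_x[OF f]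
  show "partial_t f \<in> schwartz" "mixed \<alpha> \<beta> (partial_t f) = mixed (Suc \<alpha>) \<beta> f"
    unfolding eq by (rule schwartz_family[of "\<lambda>\<alpha> \<beta>. mixed (Suc \<alpha>) \<beta> f", OF per dt dx bd])+
  show "partial_x f \<in> schwartz"
    unfolding eq by (rule schwartz_family(1)[of "\<lambda>\<alpha> \<beta>. mixed \<alpha> (Suc \<beta>) f", OF per dt dx bd])
qed

text \<open>The weight of a translate is controlled by \<open>\<bar>x\<bar> \<le> 2 max(\<bar>x + b\<bar>, \<bar>b\<bar>)\<close>, at the price of
  a factor that grows polynomially in the shift \<open>b\<close>.\<close>

lemma schwartz_mixed_bound_shift:
  assumes f: "f \<in> schwartz"
  shows "\<bar>x\<bar> ^ \<gamma> * norm (mixed \<alpha> \<beta> f (t, x + b)) \<le>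
    2 ^ \<gamma> * (schwartz_norm \<alpha> \<beta> \<gamma> f + \<bar>b\<bar> ^ \<gamma> * schwartz_norm \<alpha> \<beta> 0 f)"
proof -
  let ?m = "norm (mixed \<alpha> \<beta> f (t, x + b))"
  have "\<bar>x\<bar> \<le> \<bar>x + b\<bar> + \<bar>b\<bar>"
    using abs_triangle_ineq4[of "x + b" b] by simp
  also have "\<dots> \<le> 2 * max \<bar>x + b\<bar> \<bar>b\<bar>"
    by (simp add: max_def)
  finally have "\<bar>x\<bar> \<le> 2 * max \<bar>x + b\<bar> \<bar>b\<bar>" .
  then have "\<bar>x\<bar> ^ \<gamma> \<le> 2 ^ \<gamma> * max \<bar>x + b\<bar> \<bar>b\<bar> ^ \<gamma>"
    by (metis abs_ge_zero power_mono power_mult_distrib)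
  also have "max \<bar>x + b\<bar> \<bar>b\<bar> ^ \<gamma> \<le> \<bar>x + b\<bar> ^ \<gamma> + \<bar>b\<bar> ^ \<gamma>"
    by (cases "\<bar>x + b\<bar> \<le> \<bar>b\<bar>") (auto simp: max_def)
  finally have "\<bar>x\<bar> ^ \<gamma> * ?m \<le> 2 ^ \<gamma> * (\<bar>x + b\<bar> ^ \<gamma> + \<bar>b\<bar> ^ \<gamma>) * ?m"
    by (intro mult_right_mono) auto
  also have "\<dots> = 2 ^ \<gamma> * (\<bar>x + b\<bar> ^ \<gamma> * ?m + \<bar>b\<bar> ^ \<gamma> * (\<bar>x + b\<bar> ^ 0 * ?m))"
    by (simp add: algebra_simps)
  also have "\<dots> \<le> 2 ^ \<gamma> * (schwartz_norm \<alpha> \<beta> \<gamma> f + \<bar>b\<bar> ^ \<gamma> * schwartz_norm \<alpha> \<beta> 0 f)"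
    by (intro mult_left_mono add_mono schwartz_mixed_bound f) auto
  finally show ?thesis .
qed

lemma
  assumes f: "f \<in> schwartz"
  shows schwartz_translate: "(\<lambda>(t, x). f (t + a, x + b)) \<in> schwartz" (is "?f \<in> _")
    and mixed_translate: "mixed \<alpha> \<beta> (\<lambda>(t, x). f (t + a, x + b)) =
      (\<lambda>(t, x). mixed \<alpha> \<beta> f (t + a, x + b))"
proof -
  define d where "d \<alpha> \<beta> = (\<lambda>(t, x). mixed \<alpha> \<beta> f (t + a, x + b))" for \<alpha> \<beta>
  have 1: "periodic_t (d 0 0)"
    using schwartz_periodic[OF f]
    by (simp add: periodic_t_def d_def) (metis add.assoc add.commute)
  have 2: "((\<lambda>s. d \<alpha> \<beta> (s, x)) has_vector_derivative d (Suc \<alpha>) \<beta> (t, x)) (at t)" for \<alpha> \<beta> t x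
  proof -
    have "((\<lambda>s. mixed \<alpha> \<beta> f (s, x + b)) \<circ> (\<lambda>s. s + a) has_vector_derivative
        1 *\<^sub>R mixed (Suc \<alpha>) \<beta> f (t + a, x + b)) (at t)"
      by (rule vector_diff_chain_at[OF _ schwartz_mixed_deriv_t[OF f]])
        (auto intro!: derivative_eq_intros)
    then show ?thesis by (simp add: d_def o_def)
  qed
  have 3: "((\<lambda>y. d \<alpha> \<beta> (t, y)) has_vector_derivative d \<alpha> (Suc \<beta>) (t, x)) (at x)" for \<alpha> \<beta> t x
  proof -
    have "((\<lambda>y. mixed \<alpha> \<beta> f (t + a, y)) \<circ> (\<lambda>y. y + b) has_vector_derivative
        1 *\<^sub>R mixed \<alpha> (Suc \<beta>) f (t + a, x + b)) (at x)"
      by (rule vector_diff_chain_at[OF _ schwartz_mixed_deriv_x[OF f]])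
        (auto intro!: derivative_eq_intros)
    then show ?thesis by (simp add: d_def o_def)
  qed
  have 4: "\<exists>C. \<forall>t x. \<bar>x\<bar> ^ \<gamma> * norm (d \<alpha> \<beta> (t, x)) \<le> C" for \<alpha> \<beta> \<gamma>
  proof (intro exI allI)
    fix t x
    show "\<bar>x\<bar> ^ \<gamma> * norm (d \<alpha> \<beta> (t, x)) \<le>
        2 ^ \<gamma> * (schwartz_norm \<alpha> \<beta> \<gamma> f + \<bar>b\<bar> ^ \<gamma> * schwartz_norm \<alpha> \<beta> 0 f)"
      unfolding d_def prod.case by (rule schwartz_mixed_bound_shift[OF f])
  qed
  have "d 0 0 = ?f" by (auto simp add: d_def)
  with schwartz_family[OF 1 2 3 4]
  show "?f \<in> schwartz"
    "mixed \<alpha> \<beta> ?f = (\<lambda>(t, x). mixed \<alpha> \<beta> f (t + a, x + b))"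
    by (simp_all add: d_def)
qed

section \<open>Integrals of families of Schwartz functions\<close>

lemma norm_integral_le:
  fixes f :: "'s \<Rightarrow> complex"
  assumes "integrable N f" and "integrable N M" and "\<And>s. norm (f s) \<le> M s"
  shows "norm (\<integral>s. f s \<partial>N) \<le> (\<integral>s. M s \<partial>N)"
  using assms by (intro order_trans[OF integral_norm_bound] integral_mono) auto

text \<open>A bound on the second derivative makes the first-order Taylor remainder uniformly small.
  This replaces dominated convergence when differentiating under an integral over an arbitrary
  measure space.\<close>

lemma quadratic_remainder:
  fixes \<phi> :: "real \<Rightarrow> complex"
  assumes 1: "\<And>t. (\<phi> has_vector_derivative \<phi>1 t) (at t)"
    and 2: "\<And>t. (\<phi>1 has_vector_derivative \<phi>2 t) (at t)"
    and M: "\<And>t. norm (\<phi>2 t) \<le> M"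
  shows "norm (\<phi> (t + h) - \<phi> t - h *\<^sub>R \<phi>1 t) \<le> M * h\<^sup>2"
proof -
  have lip: "norm (\<phi>1 s - \<phi>1 t) \<le> M * norm (s - t)" for s
    by (rule differentiable_bound[where S = UNIV and f' = "\<lambda>t h. h *\<^sub>R \<phi>2 t"])
       (use 2 M in \<open>auto simp: has_vector_derivative_def mult.commute[of M]
          intro!: onorm_bound mult_right_mono order_trans[OF norm_ge_zero M] mult_left_mono\<close>)
  have "norm (\<phi> (t + h) - \<phi> t - ((t + h) - t) *\<^sub>R \<phi>1 t) \<le> norm ((t + h) - t) * (M * norm h)"
  proof (rule vector_differentiable_bound_linearization[where S = "closed_segment t (t + h)"])
    fix s assume "s \<in> closed_segment t (t + h)"
    then have "norm (s - t) \<le> norm h"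
      by (auto simp: closed_segment_eq_real_ivl split: if_splits)
    then show "norm (\<phi>1 s - \<phi>1 t) \<le> M * norm h"
      using lip[of s] order_trans[OF norm_ge_zero M] by (meson mult_left_mono order_trans)
  qed (auto intro!: has_vector_derivative_at_within 1)
  then show ?thesis by (simp add: power2_eq_square mult_ac)
qed

lemma has_vector_derivative_integral:
  fixes \<phi> :: "'s \<Rightarrow> real \<Rightarrow> complex"
  assumes 1: "\<And>s t. (\<phi> s has_vector_derivative \<phi>1 s t) (at t)"
    and 2: "\<And>s t. (\<phi>1 s has_vector_derivative \<phi>2 s t) (at t)"
    and M: "\<And>s t. norm (\<phi>2 s t) \<le> M s" "integrable N M"
    and i0: "\<And>t. integrable N (\<lambda>s. \<phi> s t)" and i1: "\<And>t. integrable N (\<lambda>s. \<phi>1 s t)"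
  shows "((\<lambda>t. \<integral>s. \<phi> s t \<partial>N) has_vector_derivative (\<integral>s. \<phi>1 s t \<partial>N)) (at t)"
  unfolding has_vector_derivative_def has_derivative_at
proof
  show "bounded_linear (\<lambda>h. h *\<^sub>R (\<integral>s. \<phi>1 s t \<partial>N))"
    by (rule bounded_linear_scaleR_left)
  define K where "K = (\<integral>s. M s \<partial>N)"
  have le: "norm ((\<integral>s. \<phi> s (t + h) \<partial>N) - (\<integral>s. \<phi> s t \<partial>N) - h *\<^sub>R (\<integral>s. \<phi>1 s t \<partial>N)) \<le> K * h\<^sup>2" for h
  proof -
    have "(\<integral>s. \<phi> s (t + h) \<partial>N) - (\<integral>s. \<phi> s t \<partial>N) - h *\<^sub>R (\<integral>s. \<phi>1 s t \<partial>N) =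
        (\<integral>s. \<phi> s (t + h) - \<phi> s t - h *\<^sub>R \<phi>1 s t \<partial>N)"
      using i0 i1 by simp
    also have "norm \<dots> \<le> (\<integral>s. M s * h\<^sup>2 \<partial>N)"
      by (rule norm_integral_le) (use i0 i1 M quadratic_remainder[OF 1 2 M(1)] in auto)
    finally show ?thesis by (simp add: K_def)
  qed
  show "(\<lambda>h. norm ((\<integral>s. \<phi> s (t + h) \<partial>N) - (\<integral>s. \<phi> s t \<partial>N) - h *\<^sub>R (\<integral>s. \<phi>1 s t \<partial>N)) / norm h)
      \<midarrow>0\<rightarrow> 0"
  proof (rule Lim_null_comparison)
    show "\<forall>\<^sub>F h in at 0. norm (norm ((\<integral>s. \<phi> s (t + h) \<partial>N) - (\<integral>s. \<phi> s t \<partial>N) -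
        h *\<^sub>R (\<integral>s. \<phi>1 s t \<partial>N)) / norm h) \<le> K * \<bar>h\<bar>"
    proof (rule always_eventually, rule allI)
      fix h
      have "norm ((\<integral>s. \<phi> s (t + h) \<partial>N) - (\<integral>s. \<phi> s t \<partial>N) - h *\<^sub>R (\<integral>s. \<phi>1 s t \<partial>N)) \<le>
          (K * \<bar>h\<bar>) * \<bar>h\<bar>"
        using le[of h] by (simp add: power2_eq_square mult.assoc)
      then show "norm (norm ((\<integral>s. \<phi> s (t + h) \<partial>N) - (\<integral>s. \<phi> s t \<partial>N) -
          h *\<^sub>R (\<integral>s. \<phi>1 s t \<partial>N)) / norm h) \<le> K * \<bar>h\<bar>"
        by (cases "h = 0") (simp_all add: divide_le_eq)
    qed
    show "(\<lambda>h. K * \<bar>h\<bar>) \<midarrow>0\<rightarrow> 0"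
      by (auto intro!: tendsto_eq_intros)
  qed
qed

text \<open>Since every derivative of a Schwartz function is again controlled by a seminorm,
  integrable seminorms give the second-derivative bounds that \<open>has_vector_derivative_integral\<close>
  asks for at every order.\<close>

lemma
  fixes F :: "'s \<Rightarrow> cfun"
  assumes F: "\<And>s. F s \<in> schwartz"
    and meas: "\<And>\<alpha> \<beta> z. (\<lambda>s. mixed \<alpha> \<beta> (F s) z) \<in> borel_measurable N"
    and bd: "\<And>\<alpha> \<beta> \<gamma> s. schwartz_norm \<alpha> \<beta> \<gamma> (F s) \<le> M \<alpha> \<beta> \<gamma> s"
    and int: "\<And>\<alpha> \<beta> \<gamma>. integrable N (M \<alpha> \<beta> \<gamma>)"
  shows schwartz_integral: "(\<lambda>z. \<integral>s. F s z \<partial>N) \<in> schwartz"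
    and mixed_integral: "mixed \<alpha> \<beta> (\<lambda>z. \<integral>s. F s z \<partial>N) = (\<lambda>z. \<integral>s. mixed \<alpha> \<beta> (F s) z \<partial>N)"
    and integrable_mixed: "integrable N (\<lambda>s. mixed \<alpha> \<beta> (F s) z)"
    and schwartz_norm_integral:
      "schwartz_norm \<alpha> \<beta> \<gamma> (\<lambda>z. \<integral>s. F s z \<partial>N) \<le> (\<integral>s. M \<alpha> \<beta> \<gamma> s \<partial>N)"
proof -
  have b: "\<bar>x\<bar> ^ \<gamma> * norm (mixed \<alpha> \<beta> (F s) (t, x)) \<le> M \<alpha> \<beta> \<gamma> s" for \<alpha> \<beta> \<gamma> s t x
    using schwartz_mixed_bound[OF F] bd by (rule order_trans)
  have b0: "norm (mixed \<alpha> \<beta> (F s) z) \<le> M \<alpha> \<beta> 0 s" for \<alpha> \<beta> s z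
    using b[of "snd z" 0 \<alpha> \<beta> s "fst z"] by simp
  have i: "integrable N (\<lambda>s. mixed \<alpha> \<beta> (F s) z)" for \<alpha> \<beta> z
    by (rule Bochner_Integration.integrable_bound[OF int[of \<alpha> \<beta> 0] meas])
      (auto intro!: order_trans[OF b0])
  then show "integrable N (\<lambda>s. mixed \<alpha> \<beta> (F s) z)" .
  define d where "d \<alpha> \<beta> = (\<lambda>z. \<integral>s. mixed \<alpha> \<beta> (F s) z \<partial>N)" for \<alpha> \<beta>
  have 1: "periodic_t (d 0 0)"
    using schwartz_periodic[OF F] by (simp add: periodic_t_def d_def)
  have 2: "((\<lambda>s. d \<alpha> \<beta> (s, x)) has_vector_derivative d (Suc \<alpha>) \<beta> (t, x)) (at t)" for \<alpha> \<beta> t x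
    unfolding d_def
    by (rule has_vector_derivative_integral[OF schwartz_mixed_deriv_t[OF F]
        schwartz_mixed_deriv_t[OF F] b0 int i i])
  have 3: "((\<lambda>y. d \<alpha> \<beta> (t, y)) has_vector_derivative d \<alpha> (Suc \<beta>) (t, x)) (at x)" for \<alpha> \<beta> t x
    unfolding d_def
    by (rule has_vector_derivative_integral[OF schwartz_mixed_deriv_x[OF F]
        schwartz_mixed_deriv_x[OF F] b0 int i i])
  have 4: "\<bar>x\<bar> ^ \<gamma> * norm (d \<alpha> \<beta> (t, x)) \<le> (\<integral>s. M \<alpha> \<beta> \<gamma> s \<partial>N)" for \<alpha> \<beta> \<gamma> t x
  proof -
    have "\<bar>x\<bar> ^ \<gamma> * norm (d \<alpha> \<beta> (t, x)) = norm (\<integral>s. of_real (\<bar>x\<bar> ^ \<gamma>) * mixed \<alpha> \<beta> (F s) (t, x) \<partial>N)"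
      using i by (simp add: d_def norm_mult norm_power)
    also have "\<dots> \<le> (\<integral>s. M \<alpha> \<beta> \<gamma> s \<partial>N)"
      by (rule norm_integral_le) (use i b int in \<open>auto simp: norm_mult norm_power\<close>)
    finally show ?thesis .
  qed
  then have 5: "\<exists>C. \<forall>t x. \<bar>x\<bar> ^ \<gamma> * norm (d \<alpha> \<beta> (t, x)) \<le> C" for \<alpha> \<beta> \<gamma> by blast
  have e: "d 0 0 = (\<lambda>z. \<integral>s. F s z \<partial>N)" by (simp add: d_def)
  note fam = schwartz_family[OF 1 2 3 5, unfolded e]
  show "(\<lambda>z. \<integral>s. F s z \<partial>N) \<in> schwartz" by (rule fam)
  show m: "mixed \<alpha> \<beta> (\<lambda>z. \<integral>s. F s z \<partial>N) = (\<lambda>z. \<integral>s. mixed \<alpha> \<beta> (F s) z \<partial>N)" for \<alpha> \<beta>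
    by (simp add: fam d_def)
  show "schwartz_norm \<alpha> \<beta> \<gamma> (\<lambda>z. \<integral>s. F s z \<partial>N) \<le> (\<integral>s. M \<alpha> \<beta> \<gamma> s \<partial>N)"
    by (rule schwartz_norm_leI) (use 4 in \<open>simp add: fam\<close>)
qed

text \<open>Convolution with the complex measure \<open>w(s) ds\<close> carried by the line of direction
  \<open>(v1, v2)\<close>.\<close>

definition convolve :: "real \<Rightarrow> real \<Rightarrow> (real \<Rightarrow> complex) \<Rightarrow> cfun \<Rightarrow> cfun" where
  "convolve v1 v2 w f = (\<lambda>(t, x). \<integral>s. w s * f (t - s * v1, x - s * v2) \<partial>lborel)"

text \<open>The shift by \<open>s v2\<close> costs a factor polynomial in \<open>s\<close>, so the kernel needs finite
  moments. The bounds involve the kernel only through its majorant \<open>W\<close>, which makes them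
  uniform over families of kernels with a common majorant.\<close>

lemma
  assumes f: "f \<in> schwartz" and w: "w \<in> borel_measurable borel"
    and W: "\<And>s. norm (w s) \<le> W s" and iW: "\<And>\<gamma>. integrable lborel (\<lambda>s. \<bar>s * v2\<bar> ^ \<gamma> * W s)"
  shows schwartz_convolve: "convolve v1 v2 w f \<in> schwartz"
    and mixed_convolve: "mixed \<alpha> \<beta> (convolve v1 v2 w f) = convolve v1 v2 w (mixed \<alpha> \<beta> f)"
    and integrable_convolve:
      "integrable lborel (\<lambda>s. w s * f (t - s * v1, x - s * v2))"
    and schwartz_norm_convolve: "schwartz_norm \<alpha> \<beta> \<gamma> (convolve v1 v2 w f) \<le>
      2 ^ \<gamma> * ((\<integral>s. W s \<partial>lborel) * schwartz_norm \<alpha> \<beta> \<gamma> f +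
        (\<integral>s. \<bar>s * v2\<bar> ^ \<gamma> * W s \<partial>lborel) * schwartz_norm \<alpha> \<beta> 0 f)"
proof -
  define F where "F s = (\<lambda>z. w s * (\<lambda>(t, x). f (t + (- s * v1), x + (- s * v2))) z)" for s
  define M where "M \<alpha> \<beta> \<gamma> s = 2 ^ \<gamma> * (W s * schwartz_norm \<alpha> \<beta> \<gamma> f +
      (\<bar>s * v2\<bar> ^ \<gamma> * W s) * schwartz_norm \<alpha> \<beta> 0 f)" for \<alpha> \<beta> \<gamma> s
  have iW0: "integrable lborel W" using iW[of 0] by simp
  have S: "F s \<in> schwartz" for s
    unfolding F_def by (intro schwartz_mult_left schwartz_translate f)
  have m: "mixed \<alpha> \<beta> (F s) = (\<lambda>(t, x). w s * mixed \<alpha> \<beta> f (t - s * v1, x - s * v2))" for \<alpha> \<beta> s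
    unfolding F_def mixed_mult_left[OF schwartz_translate[OF f]] mixed_translate[OF f] by auto
  have meas: "(\<lambda>s. mixed \<alpha> \<beta> (F s) z) \<in> borel_measurable lborel" for \<alpha> \<beta> z
  proof -
    have "continuous_on UNIV (\<lambda>s. mixed \<alpha> \<beta> f (fst z - s * v1, snd z - s * v2))"
      by (rule continuous_on_compose2[OF schwartz_mixed_continuous[OF f]]) (auto
          intro!: continuous_intros)
    then have "(\<lambda>s. mixed \<alpha> \<beta> f (fst z - s * v1, snd z - s * v2)) \<in> borel_measurable borel"
      by (rule borel_measurable_continuous_onI)
    then show ?thesis using w by (auto simp: m case_prod_beta)
  qed
  have bd: "schwartz_norm \<alpha> \<beta> \<gamma> (F s) \<le> M \<alpha> \<beta> \<gamma> s" for \<alpha> \<beta> \<gamma> s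
  proof (rule schwartz_norm_leI)
    fix t x
    let ?B = "2 ^ \<gamma> * (schwartz_norm \<alpha> \<beta> \<gamma> f + \<bar>s * v2\<bar> ^ \<gamma> * schwartz_norm \<alpha> \<beta> 0 f)"
    have "\<bar>x\<bar> ^ \<gamma> * norm (mixed \<alpha> \<beta> (F s) (t, x)) =
        norm (w s) * (\<bar>x\<bar> ^ \<gamma> * norm (mixed \<alpha> \<beta> f (t - s * v1, x + - (s * v2))))"
      by (simp add: m norm_mult)
    also have "\<dots> \<le> norm (w s) * ?B"
      using schwartz_mixed_bound_shift[OF f, of x \<gamma> \<alpha> \<beta> "t - s * v1" "- (s * v2)"]
      by (intro mult_left_mono) auto
    also have "\<dots> \<le> W s * ?B"
      by (intro mult_right_mono W) (simp add: schwartz_norm_nonneg f)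
    also have "\<dots> = M \<alpha> \<beta> \<gamma> s" by (simp add: M_def algebra_simps)
    finally show "\<bar>x\<bar> ^ \<gamma> * norm (mixed \<alpha> \<beta> (F s) (t, x)) \<le> M \<alpha> \<beta> \<gamma> s" .
  qed
  have iM: "integrable lborel (M \<alpha> \<beta> \<gamma>)" for \<alpha> \<beta> \<gamma>
    unfolding M_def using iW iW0 by (intro integrable_mult_right Bochner_Integration.integrable_add integrable_mult_left)
  have e: "convolve v1 v2 w f = (\<lambda>z. \<integral>s. F s z \<partial>lborel)"
    by (auto simp: convolve_def F_def)
  note I = S meas bd iM
  show "convolve v1 v2 w f \<in> schwartz"
    unfolding e by (rule schwartz_integral[OF I])
  show "mixed \<alpha> \<beta> (convolve v1 v2 w f) = convolve v1 v2 w (mixed \<alpha> \<beta> f)"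
    unfolding e mixed_integral[OF I] by (auto simp: convolve_def m)
  show "integrable lborel (\<lambda>s. w s * f (t - s * v1, x - s * v2))"
    using integrable_mixed[OF I, of 0 0 "(t, x)"] by (simp add: F_def)
  have "(\<integral>s. M \<alpha> \<beta> \<gamma> s \<partial>lborel) = 2 ^ \<gamma> * ((\<integral>s. W s \<partial>lborel) * schwartz_norm \<alpha> \<beta> \<gamma> f +
        (\<integral>s. \<bar>s * v2\<bar> ^ \<gamma> * W s \<partial>lborel) * schwartz_norm \<alpha> \<beta> 0 f)"
    unfolding M_def using iW iW0 by simp
  then show "schwartz_norm \<alpha> \<beta> \<gamma> (convolve v1 v2 w f) \<le> 2 ^ \<gamma> * ((\<integral>s. W s \<partial>lborel) *
      schwartz_norm \<alpha> \<beta> \<gamma> f + (\<integral>s. \<bar>s * v2\<bar> ^ \<gamma> * W s \<partial>lborel) * schwartz_norm \<alpha> \<beta> 0 f)"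
    unfolding e using schwartz_norm_integral[OF I] by metis
qed

section \<open>Integration over one period and integration by parts\<close>

lemma integrable_inverse_one_plus_square: "integrable lborel (\<lambda>x::real. inverse (1 + x\<^sup>2))"
  using integrable_inverse_1_plus_square by (simp add: set_integrable_def)

lemma mult_inverse_one_plus_square_ge:
  fixes a :: real
  assumes "(1 + x\<^sup>2) * a \<le> C"
  shows "a \<le> C * inverse (1 + x\<^sup>2)"
proof -
  have "0 < 1 + x\<^sup>2" by (simp add: add_pos_nonneg)
  then show ?thesis using assms by (simp add: field_simps)
qed

text \<open>The two seminorms that together control a derivative by the integrable weight
  \<open>1 / (1 + x\<^sup>2)\<close>.\<close>

definition decay_const :: "nat \<Rightarrow> nat \<Rightarrow> cfun \<Rightarrow> real" where
  "decay_const \<alpha> \<beta> f = schwartz_norm \<alpha> \<beta> 0 f + schwartz_norm \<alpha> \<beta> 2 f"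

lemma decay_const_nonneg: "f \<in> schwartz \<Longrightarrow> 0 \<le> decay_const \<alpha> \<beta> f"
  by (simp add: decay_const_def schwartz_norm_nonneg)

lemma schwartz_mixed_decay:
  assumes f: "f \<in> schwartz"
  shows "norm (mixed \<alpha> \<beta> f (t, x)) \<le> decay_const \<alpha> \<beta> f * inverse (1 + x\<^sup>2)"
  using schwartz_mixed_bound[OF f, of x 0 \<alpha> \<beta> t] schwartz_mixed_bound[OF f, of x 2 \<alpha> \<beta> t]
  by (intro mult_inverse_one_plus_square_ge) (simp add: decay_const_def algebra_simps)

abbreviation strip :: "(real \<times> real) set" where
  "strip \<equiv> {0..2 * pi} \<times> UNIV"

lemma
  fixes h :: cfun
  assumes c: "continuous_on UNIV h" and C: "\<And>t x. norm (h (t, x)) \<le> C * inverse (1 + x\<^sup>2)"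
  shows strip_integrable: "set_integrable lborel strip h"
    and norm_strip_integral: "norm (LINT z:strip|lborel. h z) \<le> C * (\<integral>z. indicator strip z
        * inverse (1 + (snd z)\<^sup>2) \<partial>lborel)"
proof -
  let ?W = "\<lambda>z::real \<times> real. indicator strip z * inverse (1 + (snd z)\<^sup>2)"
  have eq: "?W (t, x) = indicator {0..2 * pi} t * inverse (1 + x\<^sup>2)" for t x
    by (simp add: indicator_def)
  have c1: "continuous_on UNIV (\<lambda>z::real \<times> real. inverse (1 + (snd z)\<^sup>2))"
    by (intro continuous_intros) (simp add: add_nonneg_eq_0_iff)
  have S: "strip \<in> sets borel" by (intro borel_closed closed_Times) auto
  have meas: "?W \<in> borel_measurable borel"
    using S borel_measurable_continuous_onI[OF c1]
        by (intro borel_measurable_times borel_measurable_indicator)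
  have "integrable (lborel \<Otimes>\<^sub>M lborel) ?W"
  proof (rule lborel_pair.Fubini_integrable)
    show "?W \<in> borel_measurable (lborel \<Otimes>\<^sub>M lborel)"
      unfolding lborel_prod using meas by simp
    have "integrable lborel (\<lambda>t. indicator {0..2 * pi} t *\<^sub>R (\<integral>x. inverse (1
        + x\<^sup>2) \<partial>lborel) :: real)"
      by (rule integrable_real_indicator[THEN integrable_scaleR_left]) auto
    then show "integrable lborel (\<lambda>t. \<integral>x. norm (?W (t, x)) \<partial>lborel)"
      unfolding eq by (simp add: abs_mult)
    show "AE t in lborel. integrable lborel (\<lambda>x. ?W (t, x))"
      unfolding eq using integrable_inverse_one_plus_square by simp
  qed
  then have W: "integrable lborel ?W" by (simp add: lborel_prod)
  have hm: "(\<lambda>z. indicator strip z *\<^sub>R h z) \<in> borel_measurable lborel"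
    using S borel_measurable_continuous_onI[OF c]
    by (simp add: borel_measurable_scaleR borel_measurable_indicator)
  have le: "norm (indicator strip z *\<^sub>R h z) \<le> C * ?W z" for z
    using C[of "fst z" "snd z"] by (auto simp: indicator_def)
  show i: "set_integrable lborel strip h"
    unfolding set_integrable_def
    by (rule Bochner_Integration.integrable_bound[OF integrable_mult_right[OF W, of C] hm])
      (intro AE_I2 order_trans[OF le], simp only: real_norm_def abs_ge_self)
  show "norm (LINT z:strip|lborel. h z) \<le> C * (\<integral>z. ?W z \<partial>lborel)"
    using norm_integral_le[OF i[unfolded set_integrable_def] integrable_mult_right[OF W, of C] le]
    by (simp add: set_lebesgue_integral_def)
qed

lemma
  fixes h :: cfun
  assumes c: "continuous_on UNIV h" and C: "\<And>t x. norm (h (t, x)) \<le> C * inverse (1 + x\<^sup>2)"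
  shows strip_integral_tx: "(LINT z:strip|lborel. h z) =
      (\<integral>t. indicator {0..2 * pi} t *\<^sub>R (\<integral>x. h (t, x) \<partial>lborel) \<partial>lborel)"
    and strip_integral_xt: "(LINT z:strip|lborel. h z) =
      (\<integral>x. (\<integral>t. indicator {0..2 * pi} t *\<^sub>R h (t, x) \<partial>lborel) \<partial>lborel)"
proof -
  let ?h = "\<lambda>t x. indicator {0..2 * pi} t *\<^sub>R h (t, x)"
  have eq: "(\<lambda>z. indicator strip z *\<^sub>R h z) = (\<lambda>(t, x). ?h t x)"
    by (auto simp: indicator_def)
  have i: "integrable (lborel \<Otimes>\<^sub>M lborel) (\<lambda>(t, x). ?h t x)"
    using strip_integrable[OF c C] unfolding set_integrable_def eq lborel_prod .
  have "(LINT z:strip|lborel. h z) = integral\<^sup>L (lborel \<Otimes>\<^sub>M lborel) (\<lambda>(t, x). ?h t x)"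
    unfolding set_lebesgue_integral_def eq lborel_prod ..
  then show "(LINT z:strip|lborel. h z) =
      (\<integral>t. indicator {0..2 * pi} t *\<^sub>R (\<integral>x. h (t, x) \<partial>lborel) \<partial>lborel)"
    and "(LINT z:strip|lborel. h z) = (\<integral>x. (\<integral>t. ?h t x \<partial>lborel) \<partial>lborel)"
    using lborel_pair.integral_fst[OF i] lborel_pair.integral_snd[OF i] by simp_all
qed

lemma integral_derivative_eq_0:
  fixes F :: "real \<Rightarrow> complex"
  assumes F: "\<And>x. (F has_vector_derivative f x) (at x)" and f: "continuous_on UNIV f"
    and i: "integrable lborel f" and top: "(F \<longlongrightarrow> 0) at_top" and bot: "(F \<longlongrightarrow> 0) at_bot"
  shows "(\<integral>x. f x \<partial>lborel) = 0"
proof -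
  have "(LBINT x=-\<infinity>..\<infinity>. f x) = 0 - 0"
  proof (rule interval_integral_FTC_integrable)
    show "((F \<circ> real_of_ereal) \<longlongrightarrow> 0) (at_right (-\<infinity>))" "((F \<circ> real_of_ereal) \<longlongrightarrow> 0) (at_left \<infinity>)"
      by (simp_all add: ereal_tendsto_simps top bot)
    show "isCont f x" for x
      using f by (simp add: continuous_on_eq_continuous_at)
    show "set_integrable lborel (einterval (-\<infinity>) \<infinity>) f"
      using i by (simp add: set_integrable_def)
  qed (auto intro: F)
  then show ?thesis by (simp add: interval_lebesgue_integral_def set_lebesgue_integral_def)
qed

lemma integral_indicator_Icc_derivative:
  fixes F :: "real \<Rightarrow> complex"
  assumes "a \<le> b" and "\<And>x. (F has_vector_derivative f x) (at x)" and "continuous_on UNIV f"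
  shows "(\<integral>x. indicator {a..b} x *\<^sub>R f x \<partial>lborel) = F b - F a"
  using assms
  by (intro integral_FTC_atLeastAtMost)
    (auto intro: has_vector_derivative_at_within continuous_on_subset)

lemma tendsto_inverse_one_plus_square:
  "((\<lambda>x::real. C * inverse (1 + x\<^sup>2)) \<longlongrightarrow> 0) at_top" "((\<lambda>x::real. C * inverse (1 + x\<^sup>2)) \<longlongrightarrow> 0) at_bot"
proof -
  have 1: "((\<lambda>x::real. inverse (1 + x\<^sup>2)) \<longlongrightarrow> 0) at_top"
    by (intro tendsto_inverse_0_at_top filterlim_tendsto_add_at_top[OF tendsto_const]
        filterlim_pow_at_top filterlim_ident) auto
  then have 2: "((\<lambda>x::real. inverse (1 + x\<^sup>2)) \<longlongrightarrow> 0) at_bot"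
    by (simp add: filterlim_at_bot_mirror)
  show "((\<lambda>x::real. C * inverse (1 + x\<^sup>2)) \<longlongrightarrow> 0) at_top"
    "((\<lambda>x::real. C * inverse (1 + x\<^sup>2)) \<longlongrightarrow> 0) at_bot"
    using tendsto_mult_right_zero[OF 1] tendsto_mult_right_zero[OF 2] by auto
qed

text \<open>Total derivatives integrate to zero over the cylinder: in \<open>t\<close> by periodicity, in \<open>x\<close> by
  decay. Fubini's theorem allows the variable of differentiation to be integrated first.\<close>

lemma
  fixes h ht hx :: cfun
  assumes per: "periodic_t h"
    and c: "continuous_on UNIV h" "continuous_on UNIV ht" "continuous_on UNIV hx"
    and dt: "\<And>t x. ((\<lambda>s. h (s, x)) has_vector_derivative ht (t, x)) (at t)"
    and dx: "\<And>t x. ((\<lambda>y. h (t, y)) has_vector_derivative hx (t, x)) (at x)"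
    and C: "\<And>t x. norm (h (t, x)) \<le> C * inverse (1 + x\<^sup>2)"
      "\<And>t x. norm (ht (t, x)) \<le> C * inverse (1 + x\<^sup>2)"
      "\<And>t x. norm (hx (t, x)) \<le> C * inverse (1 + x\<^sup>2)"
  shows strip_integral_deriv_t: "(LINT z:strip|lborel. ht z) = 0"
    and strip_integral_deriv_x: "(LINT z:strip|lborel. hx z) = 0"
proof -
  have "(\<integral>t. indicator {0..2 * pi} t *\<^sub>R ht (t, x) \<partial>lborel) = h (2 * pi, x) - h (0, x)" for x
    by (rule integral_indicator_Icc_derivative) (auto intro: dt continuous_on_slice_t c)
  moreover have "h (2 * pi, x) = h (0, x)" for x
    using per unfolding periodic_t_def by (metis add_0)
  ultimately show "(LINT z:strip|lborel. ht z) = 0"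
    unfolding strip_integral_xt[OF c(2) C(2)] by simp
  have "(\<integral>x. hx (t, x) \<partial>lborel) = 0" for t
  proof (rule integral_derivative_eq_0[OF dx])
    show "continuous_on UNIV (\<lambda>x. hx (t, x))" by (rule continuous_on_slice_x[OF c(3)])
    then have "(\<lambda>x. hx (t, x)) \<in> borel_measurable lborel"
      by (simp add: borel_measurable_continuous_onI)
    then show "integrable lborel (\<lambda>x. hx (t, x))"
      by (rule Bochner_Integration.integrable_bound[OF
            integrable_mult_right[OF integrable_inverse_one_plus_square, of C]])
        (intro AE_I2 order_trans[OF C(3)], simp only: real_norm_def abs_ge_self)
    show "((\<lambda>x. h (t, x)) \<longlongrightarrow> 0) at_top" "((\<lambda>x. h (t, x)) \<longlongrightarrow> 0) at_bot"
      using C(1) by (auto intro!: Lim_null_comparison[OF _ tendsto_inverse_one_plus_square(1)]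
          Lim_null_comparison[OF _ tendsto_inverse_one_plus_square(2)] always_eventually)
  qed
  then show "(LINT z:strip|lborel. hx z) = 0"
    unfolding strip_integral_tx[OF c(3) C(3)] by simp
qed

text \<open>The functions that occur here next to test functions, namely Schwartz functions and plane
  waves, have in common what integration by parts needs.\<close>

definition bounded_C1 :: "cfun \<Rightarrow> cfun \<Rightarrow> cfun \<Rightarrow> bool" where
  "bounded_C1 g gt gx \<longleftrightarrow> periodic_t g \<and>
    continuous_on UNIV g \<and> continuous_on UNIV gt \<and> continuous_on UNIV gx \<and>
    (\<forall>t x. ((\<lambda>s. g (s, x)) has_vector_derivative gt (t, x)) (at t)) \<and>
    (\<forall>t x. ((\<lambda>y. g (t, y)) has_vector_derivative gx (t, x)) (at x)) \<and>
    (\<exists>B. \<forall>z. norm (g z) \<le> B \<and> norm (gt z) \<le> B \<and> norm (gx z) \<le> B)"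

lemma bounded_C1_schwartz:
  assumes f: "f \<in> schwartz"
  shows "bounded_C1 f (partial_t f) (partial_x f)"
proof -
  have eq: "f = mixed 0 0 f" "partial_t f = mixed (Suc 0) 0 f" "partial_x f = mixed 0 (Suc 0) f"
    by (simp_all add: mixed_def)
  have b: "norm (mixed \<alpha> \<beta> f z) \<le> schwartz_norm \<alpha> \<beta> 0 f" for \<alpha> \<beta> z
    using schwartz_mixed_bound[OF f, of "snd z" 0 \<alpha> \<beta> "fst z"] by simp
  define B where "B = max (schwartz_norm 0 0 0 f) (max (schwartz_norm (Suc 0) 0 0 f) (schwartz_norm 0 (Suc 0) 0 f))"
  have "norm (f z) \<le> B \<and> norm (partial_t f z) \<le> B \<and> norm (partial_x f z) \<le> B" for z
    using b[of 0 0 z] b[of "Suc 0" 0 z] b[of 0 "Suc 0" z] unfolding B_def eq(2,3) mixed_0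
    by (auto simp: le_max_iff_disj)
  moreover have "continuous_on UNIV f" "continuous_on UNIV (partial_t f)" "continuous_on UNIV (partial_x f)"
    using schwartz_mixed_continuous[OF f] eq by metis+
  ultimately show ?thesis
    unfolding bounded_C1_def
    using schwartz_periodic[OF f] smooth_deriv_t[OF schwartz_smooth[OF f]]
      smooth_deriv_x[OF schwartz_smooth[OF f]] by blast
qed

lemma bounded_mult_schwartz_decay:
  fixes g :: cfun
  assumes B: "\<And>z. norm (g z) \<le> B" and f: "f \<in> schwartz"
  shows "norm (g (t, x) * mixed \<alpha> \<beta> f (t, x)) \<le> (B * decay_const \<alpha> \<beta> f) * inverse (1 + x\<^sup>2)"
  unfolding norm_mult mult.assoc
  by (intro mult_mono B schwartz_mixed_decay f) (auto intro: order_trans[OF norm_ge_zero B])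

lemma dist_of_fun_integrable:
  fixes g :: cfun
  assumes g: "continuous_on UNIV g" "\<And>z. norm (g z) \<le> B" and f: "f \<in> schwartz"
  shows "set_integrable lborel strip (\<lambda>z. g z * f z)"
proof (rule strip_integrable)
  show "continuous_on UNIV (\<lambda>z. g z * f z)"
    using g(1) schwartz_mixed_continuous[OF f, of 0 0] by (intro continuous_on_mult) auto
qed (use bounded_mult_schwartz_decay[of g B f _ _ 0 0, OF g(2) f] in simp)

lemma dist_of_fun_add:
  fixes g :: cfun
  assumes g: "continuous_on UNIV g" "\<And>z. norm (g z) \<le> B" and f: "f \<in> schwartz" "h \<in> schwartz"
  shows "dist_of_fun g (\<lambda>z. f z + h z) = dist_of_fun g f + dist_of_fun g h"
  unfolding dist_of_fun_def distrib_left
  by (intro set_integral_add dist_of_fun_integrable[OF g] f)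

lemma dist_of_fun_mult: "dist_of_fun g (\<lambda>z. c * f z) = c * dist_of_fun g f"
proof -
  have "dist_of_fun g (\<lambda>z. c * f z) = (LINT z:strip|lborel. c * (g z * f z))"
    unfolding dist_of_fun_def by (simp add: mult.left_commute)
  then show ?thesis by (simp add: dist_of_fun_def)
qed

text \<open>The product rule for \<open>h = g f\<close>: the decay of the test function \<open>f\<close> makes up for \<open>g\<close>
  being merely bounded, so the total derivatives of \<open>h\<close> integrate to zero.\<close>

lemma
  assumes g: "bounded_C1 g gt gx" and f: "f \<in> schwartz"
  shows dist_of_fun_partial_t: "dist_of_fun g (partial_t f) = - dist_of_fun gt f"
    and dist_of_fun_partial_x: "dist_of_fun g (partial_x f) = - dist_of_fun gx f"
proof -
  obtain B where B: "\<And>z. norm (g z) \<le> B" "\<And>z. norm (gt z) \<le> B" "\<And>z. norm (gx z) \<le> B"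
    using g unfolding bounded_C1_def by blast
  have B0: "0 \<le> B" using order_trans[OF norm_ge_zero B(1)] .
  have cg: "continuous_on UNIV g" "continuous_on UNIV gt" "continuous_on UNIV gx"
    and per: "periodic_t g" using g unfolding bounded_C1_def by blast+
  have dg: "((\<lambda>s. g (s, x)) has_vector_derivative gt (t, x)) (at t)"
    "((\<lambda>y. g (t, y)) has_vector_derivative gx (t, x)) (at x)" for t x
    using g unfolding bounded_C1_def by blast+
  note cf = schwartz_mixed_continuous[OF f]
  have eq: "f = mixed 0 0 f" "partial_t f = mixed (Suc 0) 0 f" "partial_x f = mixed 0 (Suc 0) f"
    by (simp_all add: mixed_def)
  define h where "h = (\<lambda>z. g z * f z)"
  define ht where "ht = (\<lambda>z. g z * mixed (Suc 0) 0 f z + gt z * f z)"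
  define hx where "hx = (\<lambda>z. g z * mixed 0 (Suc 0) f z + gx z * f z)"
  define C where "C = B * (decay_const 0 0 f + decay_const (Suc 0) 0 f + decay_const 0 (Suc 0) f)"
  have cf0: "continuous_on UNIV f" using cf[of 0 0] by simp
  have c: "continuous_on UNIV h" "continuous_on UNIV ht" "continuous_on UNIV hx"
    unfolding h_def ht_def hx_def by (intro continuous_intros cg cf cf0)+
  have p: "periodic_t h"
    using per schwartz_periodic[OF f] by (simp add: periodic_t_def h_def)
  have dt: "((\<lambda>s. h (s, x)) has_vector_derivative ht (t, x)) (at t)" for t x
    unfolding h_def ht_def
    using has_vector_derivative_mult[OF dg(1) schwartz_mixed_deriv_t[OF f, of 0 0]] by simp
  have dx: "((\<lambda>y. h (t, y)) has_vector_derivative hx (t, x)) (at x)" for t x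
    unfolding h_def hx_def
    using has_vector_derivative_mult[OF dg(2) schwartz_mixed_deriv_x[OF f, of 0 0]] by simp
  have e: "norm (g (t, x) * f (t, x)) \<le> (B * decay_const 0 0 f) * inverse (1 + x\<^sup>2)"
    "norm (gt (t, x) * f (t, x)) \<le> (B * decay_const 0 0 f) * inverse (1 + x\<^sup>2)"
    "norm (gx (t, x) * f (t, x)) \<le> (B * decay_const 0 0 f) * inverse (1 + x\<^sup>2)"
    "norm (g (t, x) * mixed (Suc 0) 0 f (t, x)) \<le> (B * decay_const (Suc 0) 0 f) * inverse (1 + x\<^sup>2)"
    "norm (g (t, x) * mixed 0 (Suc 0) f (t, x)) \<le> (B * decay_const 0 (Suc 0) f) * inverse (1 + x\<^sup>2)"
    for t x
    using bounded_mult_schwartz_decay[of g B f t x 0 0, OF B(1) f]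
      bounded_mult_schwartz_decay[of gt B f t x 0 0, OF B(2) f]
      bounded_mult_schwartz_decay[of gx B f t x 0 0, OF B(3) f]
      bounded_mult_schwartz_decay[of g B f t x "Suc 0" 0, OF B(1) f]
      bounded_mult_schwartz_decay[of g B f t x 0 "Suc 0", OF B(1) f] by simp_all
  have pos: "0 \<le> (B * decay_const \<alpha> \<beta> f) * inverse (1 + x\<^sup>2)" for \<alpha> \<beta> and x :: real
    by (simp add: B0 decay_const_nonneg[OF f])
  have Ce: "C * w = B * decay_const 0 0 f * w + B * decay_const (Suc 0) 0 f * w + B
      * decay_const 0 (Suc 0) f * w" for w
    by (simp add: C_def algebra_simps)
  have C: "norm (h (t, x)) \<le> C * inverse (1 + x\<^sup>2)" "norm (ht (t, x)) \<le> C * inverse (1 + x\<^sup>2)"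
    "norm (hx (t, x)) \<le> C * inverse (1 + x\<^sup>2)" for t x
    unfolding h_def ht_def hx_def Ce
    using e[of t x] pos[of 0 0 x] pos[of "Suc 0" 0 x] pos[of 0 "Suc 0" x]
      norm_triangle_ineq[of "g (t, x) * mixed (Suc 0) 0 f (t, x)" "gt (t, x) * f (t, x)"]
      norm_triangle_ineq[of "g (t, x) * mixed 0 (Suc 0) f (t, x)" "gx (t, x) * f (t, x)"]
    by linarith+
  note S = schwartz_partial_t[OF f] schwartz_partial_x[OF f]
  have "(LINT z:strip|lborel. ht z) = dist_of_fun g (partial_t f) + dist_of_fun gt f"
    unfolding ht_def dist_of_fun_def eq(2)[symmetric]
    by (intro set_integral_add dist_of_fun_integrable[OF cg(1) B(1) S(1)]
        dist_of_fun_integrable[OF cg(2) B(2) f])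
  then show "dist_of_fun g (partial_t f) = - dist_of_fun gt f"
    using strip_integral_deriv_t[OF p c dt dx C] by (simp add: eq_neg_iff_add_eq_0)
  have "(LINT z:strip|lborel. hx z) = dist_of_fun g (partial_x f) + dist_of_fun gx f"
    unfolding hx_def dist_of_fun_def eq(3)[symmetric]
    by (intro set_integral_add dist_of_fun_integrable[OF cg(1) B(1) S(2)]
        dist_of_fun_integrable[OF cg(3) B(3) f])
  then show "dist_of_fun g (partial_x f) = - dist_of_fun gx f"
    using strip_integral_deriv_x[OF p c dt dx C] by (simp add: eq_neg_iff_add_eq_0)
qed

section \<open>Fourier modes in the periodic variable\<close>

abbreviation wave :: "int \<Rightarrow> real \<Rightarrow> complex" where
  "wave k s \<equiv> exp (\<i> * of_int k * of_real s)"

lemma wave_deriv: "(wave k has_vector_derivative \<i> * of_int k * wave k s) (at s)"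
proof -
  have "((\<lambda>z. exp (\<i> * of_int k * z)) has_field_derivative \<i> * of_int k
      * wave k s) (at (of_real s))"
    by (auto intro!: derivative_eq_intros)
  from has_vector_derivative_real_field[OF this] show ?thesis .
qed

lemma wave_2pi: "wave k (2 * pi) = 1"
proof -
  have "exp (complex_of_int k * (complex_of_real (2 * pi) * \<i>)) = 1"
    using exp_integer_2pi[of "of_int k"] by (simp add: mult_ac)
  then show ?thesis by (simp add: mult_ac)
qed

lemma norm_wave [simp]: "norm (wave k s) = 1"
  by (simp add: norm_exp_eq_Re)

lemma wave_continuous: "continuous_on S (wave k)"
  by (intro continuous_intros)

text \<open>The projection \<open>P\<^sub>k f\<close> with \<open>P\<^sub>k f(t, x) = e\<^bsup>ikt\<^esup> f\<^sub>k(x)\<close>, where \<open>f\<^sub>k(x)\<close> is the \<open>k\<close>-th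
  Fourier coefficient of \<open>f(\<cdot>, x)\<close>. Written as a convolution over one period it visibly
  commutes with all derivatives.\<close>

definition fourier_mode :: "int \<Rightarrow> cfun \<Rightarrow> cfun" where
  "fourier_mode k = convolve 1 0 (\<lambda>s. indicator {0..2 * pi} s * wave k s / (2 * pi))"

lemma fourier_mode_eq:
  "fourier_mode k f (t, x) = (\<integral>s. indicator {0..2 * pi} s *\<^sub>R (wave k s * f (t - s,
      x)) \<partial>lborel) / (2 * pi)"
proof -
  have "fourier_mode k f (t, x) = (\<integral>s. indicator {0..2 * pi} s *\<^sub>R (wave k s * f (t - s, x)) / (2
      * pi) \<partial>lborel)"
    unfolding fourier_mode_def convolve_def prod.case
    by (intro Bochner_Integration.integral_cong refl) (simp add: indicator_def)
  then show ?thesis by simp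
qed

abbreviation mode_weight :: "real \<Rightarrow> real" where
  "mode_weight s \<equiv> indicator {0..2 * pi} s / (2 * pi)"

lemma
  assumes f: "f \<in> schwartz"
  shows schwartz_fourier_mode: "fourier_mode k f \<in> schwartz"
    and mixed_fourier_mode: "mixed \<alpha> \<beta> (fourier_mode k f) = fourier_mode k (mixed \<alpha> \<beta> f)"
    and integrable_fourier_mode:
      "integrable lborel (\<lambda>s. indicator {0..2 * pi} s *\<^sub>R (wave k s * f (t - s, x)))"
    and schwartz_norm_fourier_mode: "schwartz_norm \<alpha> \<beta> \<gamma> (fourier_mode k f) \<le>
      2 ^ \<gamma> * (schwartz_norm \<alpha> \<beta> \<gamma> f + schwartz_norm \<alpha> \<beta> 0 f)"
proof -
  let ?w = "\<lambda>s. indicator {0..2 * pi} s * wave k s / (2 * pi)"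
  have iW: "integrable lborel mode_weight" by simp
  have i: "(\<integral>s. mode_weight s \<partial>lborel) = 1" by simp
  have m: "?w \<in> borel_measurable borel"
    by (intro borel_measurable_divide borel_measurable_times borel_measurable_const
        borel_measurable_indicator borel_measurable_continuous_onI[OF wave_continuous]) auto
  have b: "norm (?w s) \<le> mode_weight s" for s
    by (simp add: norm_mult norm_divide indicator_def)
  have iw: "integrable lborel (\<lambda>s. \<bar>s * 0\<bar> ^ \<gamma> * mode_weight s)" for \<gamma>
    using integrable_mult_right[OF iW, of "0 ^ \<gamma>"] by simp
  note c = schwartz_convolve[OF f m b iw] mixed_convolve[OF f m b iw]
    integrable_convolve[OF f m b iw] schwartz_norm_convolve[OF f m b iw]
  show "fourier_mode k f \<in> schwartz" "mixed \<alpha> \<beta> (fourier_mode k f) = fourier_mode k (mixed \<alpha> \<beta> f)"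
    unfolding fourier_mode_def using c(1,2) by blast+
  have "indicator {0..2 * pi} s *\<^sub>R (wave k s * f (t - s, x)) = (2 * pi) * (?w s * f (t - s * 1,
      x - s * 0))" for s
    by (simp add: indicator_def)
  then show "integrable lborel (\<lambda>s. indicator {0..2 * pi} s *\<^sub>R (wave k s * f (t - s, x)))"
    using integrable_mult_right[OF integrable_convolve[OF f m b iw, of t 1 x], of "2 * pi"] by simp
  have z: "(\<integral>s. \<bar>s * 0\<bar> ^ \<gamma> * mode_weight s \<partial>lborel) = 0 ^ \<gamma>" by simp
  have "(0::real) ^ \<gamma> * schwartz_norm \<alpha> \<beta> 0 f \<le> schwartz_norm \<alpha> \<beta> 0 f"
    using schwartz_norm_nonneg[OF f] by (cases \<gamma>) auto
  then show "schwartz_norm \<alpha> \<beta> \<gamma> (fourier_mode k f) \<le>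
      2 ^ \<gamma> * (schwartz_norm \<alpha> \<beta> \<gamma> f + schwartz_norm \<alpha> \<beta> 0 f)"
    unfolding fourier_mode_def by (intro order_trans[OF c(4)]) (simp add: z)
qed

lemma fourier_mode_mult:
  "fourier_mode k (\<lambda>z. c * f z) = (\<lambda>z. c * fourier_mode k f z)"
proof
  fix z :: "real \<times> real"
  obtain t x where z: "z = (t, x)" by force
  have "indicator {0..2 * pi} s *\<^sub>R (wave k s * (c * f (t - s, x))) =
      c * (indicator {0..2 * pi} s *\<^sub>R (wave k s * f (t - s, x)))" for s
    by (simp add: indicator_def)
  then show "fourier_mode k (\<lambda>z. c * f z) z = c * fourier_mode k f z"
    by (simp only: z fourier_mode_eq integral_mult_right_zero times_divide_eq_right)
qed

lemma fourier_mode_diff: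
  assumes "f \<in> schwartz" "g \<in> schwartz"
  shows "fourier_mode k (\<lambda>z. f z - g z) z = fourier_mode k f z - fourier_mode k g z"
proof -
  obtain t x where z: "z = (t, x)" by force
  show ?thesis
    using integrable_fourier_mode[OF assms(1), of k t x] integrable_fourier_mode[OF assms(2),
        of k t x]
    unfolding z fourier_mode_eq by (simp add: right_diff_distrib scaleR_diff_right diff_divide_distrib)
qed

lemma schwartz_periodic_minus:
  assumes "f \<in> schwartz"
  shows "f (t - 2 * pi, x) = f (t, x)"
  using schwartz_periodic[OF assms] unfolding periodic_t_def by (metis diff_add_cancel)

lemma reflected_deriv_t:
  assumes f: "f \<in> schwartz"
  shows "((\<lambda>s. f (t - s, x)) has_vector_derivative - partial_t f (t - s, x)) (at s)"
proof -
  have "((\<lambda>s. f (s, x)) \<circ> (\<lambda>s. t - s) has_vector_derivative (-1) *\<^sub>R partial_t f (t - s, x)) (at s)"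
    by (rule vector_diff_chain_at[OF _ smooth_deriv_t[OF schwartz_smooth[OF f]]])
      (auto intro!: derivative_eq_intros)
  then show ?thesis by (simp add: o_def)
qed

lemma wave_mult_deriv:
  assumes f: "f \<in> schwartz"
  shows "((\<lambda>s. wave k s * f (t - s, x)) has_vector_derivative
    wave k s * (\<i> * of_int k * f (t - s, x) - partial_t f (t - s, x))) (at s)"
  using has_vector_derivative_mult[OF wave_deriv reflected_deriv_t[OF f]]
  by (simp add: algebra_simps)

lemma continuous_on_reflected:
  assumes f: "f \<in> schwartz"
  shows "continuous_on S (\<lambda>s. f (t - s, x))"
  by (rule continuous_on_compose2[OF smooth_continuous_on[OF schwartz_smooth[OF f]]])
    (auto intro!: continuous_intros)

text \<open>The second identity is the fundamental theorem of calculus for \<open>e\<^bsup>iks\<^esup> f(t - s, x)\<close> over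
  a period.\<close>

lemma partial_t_fourier_mode:
  assumes f: "f \<in> schwartz"
  shows "partial_t (fourier_mode k f) = fourier_mode k (partial_t f)"
    and "fourier_mode k (partial_t f) = (\<lambda>z. \<i> * of_int k * fourier_mode k f z)"
proof -
  show "partial_t (fourier_mode k f) = fourier_mode k (partial_t f)"
    using mixed_fourier_mode[OF f, of "Suc 0" 0 k] by (simp add: mixed_def)
  show "fourier_mode k (partial_t f) = (\<lambda>z. \<i> * of_int k * fourier_mode k f z)"
  proof
    fix z :: "real \<times> real"
    obtain t x where z: "z = (t, x)" by force
    note S = schwartz_partial_t[OF f]
    let ?I = "indicator {0..2 * pi} :: real \<Rightarrow> real"
    have "(\<integral>s. ?I s *\<^sub>R (wave k s * (\<i> * of_int k * f (t - s, x) - partial_t f (t - s,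
        x))) \<partial>lborel) =
        wave k (2 * pi) * f (t - 2 * pi, x) - wave k 0 * f (t - 0, x)"
      by (rule integral_indicator_Icc_derivative[OF _ wave_mult_deriv[OF f]])
        (simp, intro continuous_intros continuous_on_reflected[OF f] continuous_on_reflected[OF S])
    also have "\<dots> = 0"
      by (simp only: wave_2pi schwartz_periodic_minus[OF f]) simp
    finally have "(\<integral>s. \<i> * of_int k * (?I s *\<^sub>R (wave k s * f (t - s, x))) -
        ?I s *\<^sub>R (wave k s * partial_t f (t - s, x)) \<partial>lborel) = 0"
      by (simp add: algebra_simps scaleR_conv_of_real)
    then have "\<i> * of_int k * (\<integral>s. ?I s *\<^sub>R (wave k s * f (t - s, x)) \<partial>lborel) -
        (\<integral>s. ?I s *\<^sub>R (wave k s * partial_t f (t - s, x)) \<partial>lborel) = 0"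
      by (subst (asm) Bochner_Integration.integral_diff[OF
            integrable_mult_right[OF integrable_fourier_mode[OF f]] integrable_fourier_mode[OF S]])
        (simp only: integral_mult_right_zero)
    then show "fourier_mode k (partial_t f) z = \<i> * of_int k * fourier_mode k f z"
      by (simp only: z fourier_mode_eq right_minus_eq times_divide_eq_right)
  qed
qed

text \<open>For \<open>j = k\<close> the integrand \<open>e\<^bsup>iks\<^esup> f(t - s, x)\<close> is constant in \<open>s\<close>. For \<open>j \<noteq> k\<close>, the
  function \<open>\<partial>\<^sub>t P\<^sub>k f\<close> is both \<open>i j P\<^sub>k f\<close> and \<open>i k P\<^sub>k f\<close>.\<close>

lemma fourier_mode_eigenfunction:
  assumes f: "f \<in> schwartz" and j: "partial_t f = (\<lambda>z. \<i> * of_int j * f z)"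
  shows "fourier_mode k f = (if j = k then f else (\<lambda>z. 0))"
proof (cases "j = k")
  case True
  show ?thesis
  proof
    fix z :: "real \<times> real"
    obtain t x where z: "z = (t, x)" by force
    have "((\<lambda>s. wave k s * f (t - s, x)) has_vector_derivative 0) (at s within UNIV)" for s
      using wave_mult_deriv[OF f, of k t x s] by (simp add: j True)
    then obtain c where c: "wave k s * f (t - s, x) = c" for s
      using has_vector_derivative_zero_constant[of UNIV "\<lambda>s. wave k s * f (t - s, x)"] by auto
    moreover have "c = f (t, x)" using c[of 0] by simp
    ultimately show "fourier_mode k f z = (if j = k then f else (\<lambda>z. 0)) z"
      unfolding z fourier_mode_eq by (simp add: True scaleR_conv_of_real)
  qed
next
  case False
  have "\<i> * of_int j * fourier_mode k f z = \<i> * of_int k * fourier_mode k f z" for z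
    using partial_t_fourier_mode(2)[OF f, of k] unfolding j fourier_mode_mult by meson
  then show ?thesis using False by auto
qed

text \<open>Each \<open>\<partial>\<^sub>t\<close> on a mode produces a factor \<open>i k\<close>, so two of them turn bounds that are
  uniform in \<open>k\<close> into summable ones.\<close>

lemma fourier_mode_decay:
  assumes f: "f \<in> schwartz"
  shows "\<exists>C. \<forall>k. schwartz_norm \<alpha> \<beta> \<gamma> (fourier_mode k f) \<le> C * inverse (1 + (of_int k)\<^sup>2)"
proof -
  define B where "B \<alpha> = 2 ^ \<gamma> * (schwartz_norm \<alpha> \<beta> \<gamma> f + schwartz_norm \<alpha> \<beta> 0 f)" for \<alpha>
  have "schwartz_norm \<alpha> \<beta> \<gamma> (fourier_mode k f) \<le> (B \<alpha> + B (Suc (Suc \<alpha>))) * inverse (1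
      + (of_int k)\<^sup>2)" for k
  proof (rule schwartz_norm_leI)
    fix t x
    let ?n = "\<lambda>\<alpha>. \<bar>x\<bar> ^ \<gamma> * norm (mixed \<alpha> \<beta> (fourier_mode k f) (t, x))"
    have b: "?n \<alpha> \<le> B \<alpha>" for \<alpha>
      unfolding B_def
      by (rule order_trans[OF schwartz_mixed_bound[OF schwartz_fourier_mode[OF f]]
          schwartz_norm_fourier_mode[OF f]])
    have s: "mixed (Suc \<alpha>) \<beta> (fourier_mode k g) = (\<lambda>z. \<i> * of_int k
        * mixed \<alpha> \<beta> (fourier_mode k g) z)"
      if g: "g \<in> schwartz" for \<alpha> g
      using mixed_partial_t[OF schwartz_fourier_mode[OF g], of \<alpha> \<beta> k] partial_t_fourier_mode[OF g,
          of k]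
        mixed_mult_left[OF schwartz_fourier_mode[OF g], of \<alpha> \<beta> "\<i> * of_int k" k] by simp
    have "?n (Suc (Suc \<alpha>)) = (of_int k)\<^sup>2 * ?n \<alpha>"
      by (simp add: s[OF f] norm_mult power2_eq_square)
    then have "(1 + (of_int k)\<^sup>2) * ?n \<alpha> = ?n \<alpha> + ?n (Suc (Suc \<alpha>))"
      by (simp only: distrib_right mult_1)
    then have "(1 + (of_int k)\<^sup>2) * ?n \<alpha> \<le> B \<alpha> + B (Suc (Suc \<alpha>))"
      using b[of \<alpha>] b[of "Suc (Suc \<alpha>)"] by linarith
    then show "?n \<alpha> \<le> (B \<alpha> + B (Suc (Suc \<alpha>))) * inverse (1 + (of_int k)\<^sup>2)"
      by (rule mult_inverse_one_plus_square_ge)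
  qed
  then show ?thesis by blast
qed

section \<open>Uniqueness of Fourier coefficients\<close>

lemma wave_integral:
  "(LINT s:{0..2 * pi}|lborel. wave k s) = (if k = 0 then 2 * pi else 0)"
proof (cases "k = 0")
  case False
  have "((\<lambda>s. wave k s / (\<i> * of_int k)) has_vector_derivative wave k s) (at s)" for s
    using has_vector_derivative_mult_left[OF wave_deriv, of k "inverse (\<i> * of_int k)" s] False
    by (simp add: field_simps)
  from integral_indicator_Icc_derivative[OF _ this, of 0 "2 * pi"] wave_continuous[of UNIV k]
  show ?thesis
    using False wave_2pi[of k] by (simp add: set_lebesgue_integral_def)
qed (simp add: set_lebesgue_integral_def scaleR_conv_of_real)

text \<open>The arc length to the nearest point of \<open>2\<pi>\<int>\<close> is comparable to the chord; the chord is
  \<open>2 sin (s / 2)\<close>, and \<open>sin y \<ge> y / 2\<close> on \<open>[0, \<pi> / 2]\<close>.\<close>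

lemma min_le_chord:
  assumes "0 \<le> s" "s \<le> 2 * pi"
  shows "min s (2 * pi - s) \<le> 2 * norm (wave 1 s - 1)"
proof -
  have sin_ge: "y / 2 \<le> sin y" if y: "0 \<le> y" "y \<le> pi / 2" for y :: real
  proof -
    have "\<bar>sin y - (\<Sum>m<3. sin_coeff m * y ^ m)\<bar> \<le> inverse (fact 3) * \<bar>y\<bar> ^ 3"
      by (rule Maclaurin_sin_bound)
    then have 1: "y - y ^ 3 / 6 \<le> sin y"
      using y by (simp add: sin_coeff_def numeral_3_eq_3 fact_numeral eval_nat_numeral abs_if split: if_splits)
    \<comment> \<open>What is needed is \<open>y\<^sup>2 \<le> 3\<close>, so that \<open>y - y\<^sup>3 / 6 \<ge> y / 2\<close>.\<close>
    have "pi \<le> 34 / 10" using pi_approx(2) by simp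
    then have "y \<le> 17 / 10" using y by linarith
    then have "y\<^sup>2 \<le> (17 / 10)\<^sup>2" using y by (intro power_mono) auto
    then have "y * y\<^sup>2 \<le> y * 3" using y by (intro mult_left_mono) (auto simp: power2_eq_square)
    then show ?thesis using 1 by (simp add: power3_eq_cube power2_eq_square)
  qed
  have "norm (wave 1 s - 1) = 2 * \<bar>sin (s / 2)\<bar>"
    using dist_exp_i_1[of s] by (simp add: mult.commute)
  also have "\<bar>sin (s / 2)\<bar> = sin (s / 2)"
    using assms by (intro abs_of_nonneg sin_ge_zero) auto
  finally have n: "norm (wave 1 s - 1) = 2 * sin (s / 2)" .
  show ?thesis
  proof (cases "s \<le> pi")
    case True
    then show ?thesis using sin_ge[of "s / 2"] assms n by auto
  next
    case False
    have "sin (s / 2) = sin (pi - s / 2)" by simp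
    then show ?thesis using sin_ge[of "pi - s / 2"] False assms n by auto
  qed
qed

lemma set_integral_sum:
  fixes f :: "'i \<Rightarrow> 's \<Rightarrow> complex"
  assumes "\<And>i. i \<in> I \<Longrightarrow> set_integrable N A (f i)"
  shows "(LINT s:A|N. \<Sum>i\<in>I. f i s) = (\<Sum>i\<in>I. LINT s:A|N. f i s)"
  using assms
  by (simp add: set_lebesgue_integral_def set_integrable_def scaleR_sum_right
      Bochner_Integration.integral_sum)

text \<open>Fejer's argument for Lipschitz functions. Let \<open>D\<close> be the sum of the first \<open>n\<close> waves.
  Then \<open>\<bar>D\<bar>\<^sup>2\<close> is a trigonometric polynomial of mass \<open>2\<pi>n\<close>, so vanishing coefficients give
  \<open>2\<pi>n \<phi>(0) = \<integral> \<bar>D\<bar>\<^sup>2 (\<phi>(0) - \<phi>)\<close>. The Lipschitz bound supplies a factor \<open>\<bar>e\<^bsup>is\<^esup> - 1\<bar>\<close>, which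
  collapses one factor \<open>D\<close> to \<open>e\<^bsup>ins\<^esup> - 1\<close>; what remains is \<open>\<integral> \<bar>D\<bar> = O(\<surd>n)\<close>. Hence
  \<open>\<phi>(0) = O(1 / \<surd>n)\<close>.\<close>

lemma fourier_uniqueness_at:
  fixes \<phi> :: "real \<Rightarrow> complex"
  assumes c: "continuous_on UNIV \<phi>"
    and lip: "\<And>s r. norm (\<phi> s - \<phi> r) \<le> C * \<bar>s - r\<bar>"
    and per: "\<phi> (2 * pi) = \<phi> 0"
    and coeff: "\<And>k. (LINT s:{0..2 * pi}|lborel. wave k s * \<phi> s) = 0"
  shows "\<phi> 0 = 0"
proof -
  have C: "0 \<le> C" using order_trans[OF norm_ge_zero lip[of 1 0]] by simp
  have si: "set_integrable lborel {0..2 * pi} g" if "continuous_on UNIV g" for g :: "real \<Rightarrow> complex"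
    using that by (intro borel_integrable_atLeastAtMost' continuous_on_subset[OF that]) auto
  have sir: "set_integrable lborel {0..2 * pi} g" if "continuous_on UNIV g" for g :: "real \<Rightarrow> real"
    using that by (intro borel_integrable_atLeastAtMost' continuous_on_subset[OF that]) auto
  have near: "norm (\<phi> 0 - \<phi> s) \<le> 2 * C * norm (wave 1 s - 1)" if s: "0 \<le> s" "s \<le> 2 * pi" for s
  proof -
    have "norm (\<phi> 0 - \<phi> s) \<le> C * min s (2 * pi - s)"
      using lip[of 0 s] lip[of "2 * pi" s] per s by (auto simp: min_def)
    also have "\<dots> \<le> C * (2 * norm (wave 1 s - 1))"
      by (intro mult_left_mono min_le_chord s C)
    finally show ?thesis by simp
  qed
  have bound: "norm (\<phi> 0) * sqrt n \<le> 4 * C" if n: "n > 0" for n :: nat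
  proof -
    define D where "D s = (\<Sum>j<n. wave (int j) s)" for s
    have cD: "continuous_on UNIV D" unfolding D_def by (intro continuous_intros)
    have sq: "of_real ((norm (D s))\<^sup>2) = (\<Sum>j<n. \<Sum>l<n. wave (int j - int l) s)" for s
      unfolding complex_norm_square D_def cnj_sum exp_cnj sum_product
      by (intro sum.cong refl) (simp add: algebra_simps flip: exp_add)
    have geo: "(wave 1 s - 1) * D s = wave (int n) s - 1" for s
    proof -
      have "wave (int j) s = wave 1 s ^ j" for j
        by (simp add: mult_ac flip: exp_of_nat_mult)
      then show ?thesis unfolding D_def by (simp add: power_diff_1_eq)
    qed
    have "(LINT s:{0..2 * pi}|lborel. of_real ((norm (D s))\<^sup>2) * \<phi> s) =
        (\<Sum>j<n. \<Sum>l<n. (LINT s:{0..2 * pi}|lborel. wave (int j - int l) s * \<phi> s))"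
      unfolding sq sum_distrib_right
      by (subst set_integral_sum | intro si continuous_intros c sum.cong refl)+
    then have 0: "(LINT s:{0..2 * pi}|lborel. of_real ((norm (D s))\<^sup>2) * \<phi> s) = 0"
      by (simp only: coeff sum.neutral_const)
    have "(LINT s:{0..2 * pi}|lborel. complex_of_real ((norm (D s))\<^sup>2)) =
        (\<Sum>j<n. \<Sum>l<n. (LINT s:{0..2 * pi}|lborel. wave (int j - int l) s))"
      unfolding sq
      by (subst set_integral_sum | intro si continuous_intros c sum.cong refl)+
    also have "\<dots> = (\<Sum>j<n. \<Sum>l<n. if l = j then 2 * pi else 0)"
      unfolding wave_integral of_real_sum by (intro sum.cong refl) auto
    also have "\<dots> = of_real (2 * pi * n)" by simp
    finally have 1: "(LINT s:{0..2 * pi}|lborel. complex_of_real ((norm (D s))\<^sup>2)) = of_real (2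
        * pi * n)" .
    then have 2: "(LINT s:{0..2 * pi}|lborel. (norm (D s))\<^sup>2) = 2 * pi * n"
      unfolding set_integral_complex_of_real of_real_eq_iff .
    have "of_real (2 * pi * n) * \<phi> 0 =
        (LINT s:{0..2 * pi}|lborel. of_real ((norm (D s))\<^sup>2) * (\<phi> 0 - \<phi> s))"
      unfolding right_diff_distrib
      by (subst set_integral_diff(2))
        (intro si continuous_intros c cD, intro si continuous_intros c cD,
          simp only: set_integral_mult_left 0 1 diff_0_right)
    also have "norm \<dots> \<le> (LINT s:{0..2 * pi}|lborel. norm (of_real ((norm (D s))\<^sup>2) * (\<phi> 0 - \<phi> s)))"
      by (rule set_integral_norm_bound) (intro si continuous_intros c cD)
    also have "\<dots> \<le> (LINT s:{0..2 * pi}|lborel. 2 * C * (sqrt n + (norm (D s))\<^sup>2 / sqrt n))"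
    proof (rule set_integral_mono)
      fix s assume s: "s \<in> {0..2 * pi}"
      have r: "0 < sqrt n" using n by simp
      have "norm (of_real ((norm (D s))\<^sup>2) * (\<phi> 0 - \<phi> s)) \<le> (norm (D s))\<^sup>2 * (2 * C
          * norm (wave 1 s - 1))"
        unfolding norm_mult using near[of s] s by (intro mult_mono) (auto simp: norm_power)
      also have "\<dots> = 2 * C * norm (D s) * norm (wave (int n) s - 1)"
        unfolding geo[symmetric] norm_mult by (simp add: power2_eq_square)
      also have "\<dots> \<le> 2 * C * norm (D s) * 2"
        using C norm_triangle_ineq4[of "wave (int n) s" 1] by (intro mult_left_mono) auto
      also have "\<dots> = 2 * C * (2 * norm (D s))" by simp
      \<comment> \<open>An arithmetic-geometric mean with the weight \<open>\<surd>n\<close>, the typical size of \<open>D\<close>, stands in for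
        the Cauchy-Schwarz inequality.\<close>
      also have "2 * norm (D s) \<le> sqrt n + (norm (D s))\<^sup>2 / sqrt n"
      proof -
        have "0 \<le> (sqrt n - norm (D s))\<^sup>2" by simp
        then have "2 * norm (D s) * sqrt n \<le> sqrt n * sqrt n + (norm (D s))\<^sup>2"
          by (simp add: power2_eq_square algebra_simps)
        then show ?thesis using r by (simp add: field_simps)
      qed
      finally show "norm (of_real ((norm (D s))\<^sup>2) * (\<phi> 0 - \<phi> s)) \<le>
          2 * C * (sqrt n + (norm (D s))\<^sup>2 / sqrt n)"
        using C by (simp add: mult_left_mono)
    qed (use n in \<open>intro sir continuous_intros c cD; simp\<close>)+
    also have "\<dots> = 2 * C * ((LINT s:{0..2 * pi}|lborel. sqrt n) +
        (LINT s:{0..2 * pi}|lborel. (norm (D s))\<^sup>2 / sqrt n))"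
      unfolding set_integral_mult_right using n
      by (intro arg_cong2[where f = "(*)"] refl set_integral_add(2) sir continuous_intros cD) auto
    also have "(LINT s:{0..2 * pi}|lborel. sqrt n) = 2 * pi * sqrt n"
      by (simp add: set_lebesgue_integral_def)
    also have "(LINT s:{0..2 * pi}|lborel. (norm (D s))\<^sup>2 / sqrt n) = 2 * pi * sqrt n"
      using n by (simp only: set_integral_divide_zero 2) (simp add: field_simps)
    finally have "norm (of_real (2 * pi * n) * \<phi> 0) \<le> (2 * pi) * (4 * C * sqrt n)"
      by (simp add: algebra_simps)
    moreover have "norm (of_real (2 * pi * n) * \<phi> 0) = (2 * pi) * (real n * norm (\<phi> 0))"
      by (simp add: norm_mult)
    ultimately have "real n * norm (\<phi> 0) \<le> 4 * C * sqrt n" by simp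
    moreover have "real n * norm (\<phi> 0) = (norm (\<phi> 0) * sqrt n) * sqrt n"
      by (simp add: mult.assoc)
    ultimately show ?thesis using n by simp
  qed
  show ?thesis
  proof (rule ccontr)
    assume "\<phi> 0 \<noteq> 0"
    then have p: "0 < norm (\<phi> 0)" by simp
    obtain n :: nat where n: "(4 * C / norm (\<phi> 0))\<^sup>2 < n" using reals_Archimedean2 by blast
    then have "n > 0" by (metis gr0I of_nat_0 not_less zero_le_power2)
    have "4 * C / norm (\<phi> 0) < sqrt n" using n real_less_rsqrt by blast
    then show False using bound[OF \<open>n > 0\<close>] p by (simp add: field_simps)
  qed
qed

lemma fourier_uniqueness:
  assumes f: "f \<in> schwartz" and 0: "\<And>k. fourier_mode k f = (\<lambda>z. 0)"
  shows "f = (\<lambda>z. 0)"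
proof
  fix z :: "real \<times> real"
  obtain t x where z: "z = (t, x)" by force
  have b: "norm (partial_t f w) \<le> schwartz_norm (Suc 0) 0 0 f" for w
    using schwartz_mixed_bound[OF f, of "snd w" 0 "Suc 0" 0 "fst w"] by (simp add: mixed_def)
  have "f (t - 0, x) = 0"
  proof (rule fourier_uniqueness_at[where \<phi> = "\<lambda>s. f (t - s, x)"])
    show "norm (f (t - s, x) - f (t - r, x)) \<le> schwartz_norm (Suc 0) 0 0 f * \<bar>s - r\<bar>" for s r
      unfolding real_norm_def[symmetric]
      by (rule differentiable_bound[where S = UNIV and f' = "\<lambda>s h. h *\<^sub>R - partial_t f (t - s, x)"])
        (use b reflected_deriv_t[OF f] in \<open>auto
          simp: has_vector_derivative_def mult.commute[of "schwartz_norm (Suc 0) 0 0 f"]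
          intro!: onorm_bound mult_right_mono schwartz_norm_nonneg[OF f] mult_left_mono\<close>)
    show "(LINT s:{0..2 * pi}|lborel. wave k s * f (t - s, x)) = 0" for k
      using fun_cong[OF 0, of k "(t, x)"] unfolding fourier_mode_eq set_lebesgue_integral_def
          by simp
    show "f (t - 2 * pi, x) = f (t - 0, x)"
      using schwartz_periodic_minus[OF f] by simp
  qed (rule continuous_on_reflected[OF f])
  then show "f z = 0" by (simp add: z)
qed

section \<open>Fourier inversion and superposition of modes\<close>

definition apply_op :: "complex \<Rightarrow> complex \<Rightarrow> complex \<Rightarrow> cfun \<Rightarrow> cfun" where
  "apply_op ct cx q g = (\<lambda>z. ct * partial_t g z + cx * partial_x g z + q * g z)"

text \<open>Sums over the integers are written as integrals over the counting measure of the
  naturals, along the enumeration \<open>0, -1, 1, -2, 2, \<dots>\<close>, whose \<open>n\<close>-th term has modulus at least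
  about \<open>n / 2\<close>.\<close>

lemma integrable_inverse_one_plus_int_decode_square:
  "integrable (count_space UNIV) (\<lambda>n. C * inverse (1 + (of_int (int_decode n))\<^sup>2) :: real)"
proof -
  have "summable (\<lambda>n. inverse ((real n) ^ 2))"
    by (rule inverse_power_summable) simp
  then have s: "summable (\<lambda>n. 8 * inverse ((real (Suc n)) ^ 2))"
    by (subst summable_Suc_iff) (rule summable_mult)
  have le: "inverse (1 + (of_int (int_decode n))\<^sup>2) \<le> 8 * inverse ((real (Suc n)) ^ 2)" for n
  proof -
    let ?k = "real_of_int (int_decode n)"
    have "int n + 1 \<le> 2 * \<bar>int_decode n\<bar> + 2"
      by (auto simp: int_decode_def sum_decode_def)
    then have "of_int (int n + 1) \<le> (of_int (2 * \<bar>int_decode n\<bar> + 2) :: real)"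
      by (simp only: of_int_le_iff)
    then have "real (Suc n) \<le> 2 * \<bar>?k\<bar> + 2" by simp
    then have "(real (Suc n))\<^sup>2 \<le> (2 * \<bar>?k\<bar> + 2)\<^sup>2"
      by (intro power_mono) auto
    also have "\<dots> \<le> 8 * (1 + ?k\<^sup>2)"
      using zero_le_power2[of "\<bar>?k\<bar> - 1"] by (simp add: power2_eq_square algebra_simps)
    finally show ?thesis by (simp add: field_simps add_pos_nonneg)
  qed
  have "summable (\<lambda>n. inverse (1 + (of_int (int_decode n))\<^sup>2) :: real)"
    by (rule summable_comparison_test'[OF s, of 0]) (use le in \<open>simp add: add_nonneg_nonneg\<close>)
  then have "summable (\<lambda>n. norm (C * inverse (1 + (of_int (int_decode n))\<^sup>2)) :: real)"
    by (simp add: abs_mult summable_mult add_nonneg_nonneg)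
  then show ?thesis by (simp only: integrable_count_space_nat_iff)
qed

lemma
  fixes G :: "int \<Rightarrow> cfun"
  assumes G: "\<And>k. G k \<in> schwartz"
    and bd: "\<And>\<alpha> \<beta> \<gamma>. \<exists>C. \<forall>k. schwartz_norm \<alpha> \<beta> \<gamma> (G k) \<le> C * inverse (1 + (of_int k)\<^sup>2)"
  defines "g \<equiv> \<lambda>z. \<integral>n. G (int_decode n) z \<partial>count_space UNIV"
  shows schwartz_series: "g \<in> schwartz"
    and mixed_series: "mixed \<alpha> \<beta> g = (\<lambda>z. \<integral>n. mixed \<alpha> \<beta> (G (int_decode n)) z \<partial>count_space UNIV)"
    and integrable_mixed_series: "integrable (count_space UNIV) (\<lambda>n. mixed \<alpha> \<beta> (G (int_decode n)) z)"
proof -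
  obtain C where C: "\<And>\<alpha> \<beta> \<gamma> k. schwartz_norm \<alpha> \<beta> \<gamma> (G k) \<le> C \<alpha> \<beta> \<gamma> * inverse (1 + (of_int k)\<^sup>2)"
    using bd by metis
  have m: "(\<lambda>n. mixed \<alpha> \<beta> (G (int_decode n)) z) \<in> borel_measurable (count_space UNIV)" for \<alpha> \<beta> z
    by simp
  note I = G m C integrable_inverse_one_plus_int_decode_square
  show "g \<in> schwartz"
    unfolding g_def by (rule schwartz_integral[OF I])
  show "mixed \<alpha> \<beta> g = (\<lambda>z. \<integral>n. mixed \<alpha> \<beta> (G (int_decode n)) z \<partial>count_space UNIV)"
    unfolding g_def by (rule mixed_integral[OF I])
  show "integrable (count_space UNIV) (\<lambda>n. mixed \<alpha> \<beta> (G (int_decode n)) z)"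
    by (rule integrable_mixed[OF I])
qed

text \<open>Absolute convergence allows the series to be integrated term by term over a period, and
  only the \<open>k\<close>-th term survives the projection.\<close>

lemma fourier_mode_series:
  assumes P: "\<And>k. P k \<in> schwartz"
    and bd: "\<And>\<alpha> \<beta> \<gamma>. \<exists>C. \<forall>k. schwartz_norm \<alpha> \<beta> \<gamma> (P k) \<le> C * inverse (1 + (of_int k)\<^sup>2)"
    and j: "\<And>k. partial_t (P k) = (\<lambda>z. \<i> * of_int k * P k z)"
  shows "fourier_mode k (\<lambda>z. \<integral>n. P (int_decode n) z \<partial>count_space UNIV) = P k"
proof
  fix z :: "real \<times> real"
  obtain t x where z: "z = (t, x)" by force
  obtain C where C: "\<And>k. schwartz_norm 0 0 0 (P k) \<le> C * inverse (1 + (of_int k)\<^sup>2)"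
    using bd by metis
  define c where "c n = C * inverse (1 + (of_int (int_decode n))\<^sup>2)" for n
  have sc: "summable c"
    using integrable_inverse_one_plus_int_decode_square[of C]
        unfolding integrable_count_space_nat_iff c_def[symmetric]
    by (rule summable_norm_cancel)
  have Pc: "norm (P (int_decode n) w) \<le> c n" for n w
    using schwartz_mixed_bound[OF P, of "snd w" 0 0 0 "int_decode n" "fst w"] C[of "int_decode n"]
    by (simp add: c_def)
  define F where "F n s = indicator {0..2 * pi} s *\<^sub>R (wave k s * P (int_decode n) (t - s, x))"
      for n s
  have iF: "integrable lborel (F n)" for n
    unfolding F_def by (rule integrable_fourier_mode[OF P])
  have nF: "norm (F n s) \<le> indicator {0..2 * pi} s * c n" for n s
    unfolding F_def using Pc[of n "(t - s, x)"] by (simp add: norm_mult indicator_def)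
  have i: "integrable lborel (\<lambda>s. indicator {0..2 * pi} s * c n)" for n
    by (intro integrable_mult_left) simp
  have "summable (\<lambda>n. (\<integral>s. norm (F n s) \<partial>lborel))"
  proof (rule summable_comparison_test'[OF summable_mult[OF sc, of "2 * pi"], of 0])
    fix n
    have "(\<integral>s. norm (F n s) \<partial>lborel) \<le> (\<integral>s. indicator {0..2 * pi} s * c n \<partial>lborel)"
      by (intro integral_mono integrable_norm iF i nF)
    then show "norm (\<integral>s. norm (F n s) \<partial>lborel) \<le> 2 * pi * c n"
      by simp
  qed
  moreover have "AE s in lborel. summable (\<lambda>n. norm (F n s))"
  proof (rule AE_I2)
    fix s
    show "summable (\<lambda>n. norm (F n s))"
      by (rule summable_comparison_test'[OF summable_mult[OF sc, of "indicator {0..2 * pi} s"],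
          of 0])
        (use nF in simp)
  qed
  ultimately have sw: "(\<integral>s. (\<Sum>n. F n s) \<partial>lborel) = (\<Sum>n. \<integral>s. F n s \<partial>lborel)"
    by (intro integral_suminf iF)
  have "indicator {0..2 * pi} s *\<^sub>R (wave k s * (\<integral>n. P (int_decode n) (t - s,
      x) \<partial>count_space UNIV)) =
      (\<Sum>n. F n s)" for s
  proof -
    have ig: "integrable (count_space UNIV) (\<lambda>n. P (int_decode n) (t - s, x))"
      using integrable_mixed_series[OF P bd, of 0 0 "(t - s, x)"] by simp
    have "(\<lambda>n. indicator {0..2 * pi} s * wave k s * P (int_decode n) (t - s, x)) sums
        (indicator {0..2 * pi} s * wave k s * (\<integral>n. P (int_decode n) (t - s, x) \<partial>count_space UNIV))"
      by (intro sums_mult sums_integral_count_space_nat ig)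
    moreover have "indicator {0..2 * pi} s * wave k s * P (int_decode n) (t - s, x) = F n s" for n
      by (simp add: F_def indicator_def)
    ultimately show ?thesis
      by (simp add: sums_iff indicator_def split: if_splits)
  qed
  then have "fourier_mode k (\<lambda>z. \<integral>n. P (int_decode n) z \<partial>count_space UNIV) z
      = (\<Sum>n. \<integral>s. F n s \<partial>lborel) / (2 * pi)"
    unfolding z fourier_mode_eq by (simp only: sw)
  also have "(\<Sum>n. \<integral>s. F n s \<partial>lborel) = 2 * pi * P k z"
  proof -
    have "(\<integral>s. F n s \<partial>lborel) = (if n = int_encode k then 2 * pi * P (int_decode n) z else 0)" for n
    proof -
      have "(\<integral>s. F n s \<partial>lborel) = 2 * pi * fourier_mode k (P (int_decode n)) z"
        unfolding F_def z fourier_mode_eq by simp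
      then show ?thesis
        unfolding fourier_mode_eigenfunction[OF P j] by auto
    qed
    then show ?thesis
      using sums_single[of "int_encode k" "\<lambda>n. 2 * pi * P (int_decode n) z"] by (simp add: sums_iff)
  qed
  finally show "fourier_mode k (\<lambda>z. \<integral>n. P (int_decode n) z \<partial>count_space UNIV) z = P k z"
    by simp
qed

text \<open>By \<open>fourier_mode_series\<close>, the sum of the modes of \<open>f\<close> has the same modes as \<open>f\<close>.\<close>

lemma fourier_inversion:
  assumes f: "f \<in> schwartz"
  shows "(\<lambda>z. \<integral>n. fourier_mode (int_decode n) f z \<partial>count_space UNIV) = f" (is "?h = f")
proof -
  note P = schwartz_fourier_mode[OF f] fourier_mode_decay[OF f]
  have h: "?h \<in> schwartz" by (rule schwartz_series[OF P])
  have j: "partial_t (fourier_mode k f) = (\<lambda>z. \<i> * of_int k * fourier_mode k f z)" for k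
    using partial_t_fourier_mode[OF f] by simp
  have "(\<lambda>z. f z - ?h z) = (\<lambda>z. 0)"
  proof (rule fourier_uniqueness)
    show "(\<lambda>z. f z - ?h z) \<in> schwartz" by (rule schwartz_diff[OF f h])
    show "fourier_mode k (\<lambda>z. f z - ?h z) = (\<lambda>z. 0)" for k
      using fourier_mode_diff[OF f h, of k] fourier_mode_series[OF P j, of k] by auto
  qed
  then show ?thesis by (auto simp: fun_eq_iff)
qed

lemma solvable_of_modes:
  assumes f: "f \<in> schwartz" and G: "\<And>k. G k \<in> schwartz"
    and bd: "\<And>\<alpha> \<beta> \<gamma>. \<exists>C. \<forall>k. schwartz_norm \<alpha> \<beta> \<gamma> (G k) \<le> C * inverse (1 + (of_int k)\<^sup>2)"
    and eq: "\<And>k. apply_op ct cx q (G k) = fourier_mode k f"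
  shows "\<exists>g\<in>schwartz. apply_op ct cx q g = f"
proof
  let ?g = "\<lambda>z. \<integral>n. G (int_decode n) z \<partial>count_space UNIV"
  show "?g \<in> schwartz" by (rule schwartz_series[OF G bd])
  note m = mixed_series[OF G bd] and i = integrable_mixed_series[OF G bd]
  have e: "partial_t h = mixed (Suc 0) 0 h" "partial_x h = mixed 0 (Suc 0) h" for h
    by (simp_all add: mixed_def)
  have "apply_op ct cx q ?g z = (\<integral>n. apply_op ct cx q (G (int_decode n)) z \<partial>count_space UNIV)" for z
    unfolding apply_op_def e m using i[of "Suc 0" 0 z] i[of 0 "Suc 0" z] i[of 0 0 z] by simp
  then show "apply_op ct cx q ?g = f"
    unfolding eq using fourier_inversion[OF f] by (simp add: fun_eq_iff)
qed

section \<open>The equation on a single mode\<close>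

lemma power_le_fact_mult_exp:
  fixes y :: real
  assumes "0 \<le> y"
  shows "y ^ m \<le> fact m * exp y"
proof -
  have "(\<Sum>n\<in>{m}. y ^ n /\<^sub>R fact n) \<le> (\<Sum>n. y ^ n /\<^sub>R fact n)"
    using assms by (intro sum_le_suminf summable_exp_generic) auto
  then show ?thesis by (simp add: exp_def field_simps)
qed

lemma integrable_power_exp:
  assumes \<delta>: "0 < \<delta>"
  shows "integrable lborel (\<lambda>s::real. \<bar>s\<bar> ^ \<gamma> * (indicator {0<..} s * exp (- \<delta> * s)))"
proof -
  define C where "C = fact \<gamma> / \<delta> ^ \<gamma> + fact (\<gamma> + 2) / \<delta> ^ (\<gamma> + 2)"
  have le: "norm (\<bar>s\<bar> ^ \<gamma> * (indicator {0<..} s * exp (- \<delta> * s))) \<le> C * inverse (1 + s\<^sup>2)"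
      for s :: real
  proof (cases "0 < s")
    case True
    have e: "s ^ m * exp (- \<delta> * s) \<le> fact m / \<delta> ^ m" for m
      using power_le_fact_mult_exp[of "\<delta> * s" m] True \<delta>
      by (simp add: exp_minus field_simps)
    have "(1 + s\<^sup>2) * (s ^ \<gamma> * exp (- \<delta> * s)) = s ^ \<gamma> * exp (- \<delta> * s) + s ^ (\<gamma> + 2) * exp (- \<delta> * s)"
      by (simp add: power_add power2_eq_square algebra_simps)
    also have "\<dots> \<le> C" unfolding C_def by (intro add_mono e)
    finally have "s ^ \<gamma> * exp (- \<delta> * s) \<le> C * inverse (1 + s\<^sup>2)"
      by (rule mult_inverse_one_plus_square_ge)
    then show ?thesis using True by simp
  next
    case False
    then show ?thesis using \<delta> by (simp add: C_def)
  qed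
  show ?thesis
  proof (rule Bochner_Integration.integrable_bound)
    show "integrable lborel (\<lambda>s. C * inverse (1 + s\<^sup>2))"
      by (rule integrable_mult_right[OF integrable_inverse_one_plus_square])
    show "AE s in lborel. norm (\<bar>s\<bar> ^ \<gamma> * (indicator {0<..} s * exp (- \<delta> * s))) \<le> norm (C
        * inverse (1 + s\<^sup>2))"
      by (intro AE_I2 order_trans[OF le], simp only: real_norm_def abs_ge_self)
  qed measurable
qed

text \<open>The decaying fundamental solution of \<open>\<partial>\<^sub>x + \<mu>\<close> lives on the half line on the side given
  by the sign of \<open>Re \<mu>\<close>. It is parametrised by the distance \<open>s\<close> to the origin, so it has to be
  convolved in the direction \<open>(0, sgn (Re \<mu>))\<close>.\<close>

definition half_line_kernel :: "complex \<Rightarrow> real \<Rightarrow> complex" where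
  "half_line_kernel \<mu> s =
    indicator {0<..} s * (of_real (sgn (Re \<mu>)) * exp (- (of_real (sgn (Re \<mu>)) * \<mu>) * of_real s))"

text \<open>With \<open>\<sigma> = sgn (Re \<mu>)\<close>, the integrand of \<open>(\<partial>\<^sub>x + \<mu>) g\<close> is minus the derivative of
  \<open>e\<^bsup>-\<sigma>\<mu>s\<^esup> f(t, x - \<sigma>s)\<close> in \<open>s\<close>, so the integral over the half line is the boundary value
  \<open>f(t, x)\<close>. The bound depends on \<open>\<mu>\<close> only through \<open>\<delta>\<close>; this uniformity is what permits the
  sum over all modes.\<close>

lemma
  assumes \<delta>: "0 < \<delta>" "\<delta> \<le> \<bar>Re \<mu>\<bar>" and f: "f \<in> schwartz"
  defines "g \<equiv> convolve 0 (sgn (Re \<mu>)) (half_line_kernel \<mu>) f"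
  shows schwartz_half_line: "g \<in> schwartz"
    and mixed_half_line: "mixed \<alpha> \<beta> g = convolve 0 (sgn (Re \<mu>)) (half_line_kernel \<mu>) (mixed \<alpha> \<beta> f)"
    and half_line_solves: "partial_x g z + \<mu> * g z = f z"
    and schwartz_norm_half_line: "schwartz_norm \<alpha> \<beta> \<gamma> g \<le>
      2 ^ \<gamma> * ((\<integral>s. indicator {0<..} s * exp (- \<delta> * s) \<partial>lborel) * schwartz_norm \<alpha> \<beta> \<gamma> f +
        (\<integral>s. \<bar>s\<bar> ^ \<gamma> * (indicator {0<..} s * exp (- \<delta> * s)) \<partial>lborel) * schwartz_norm \<alpha> \<beta> 0 f)"
proof -
  define \<sigma> where "\<sigma> = sgn (Re \<mu>)"
  have \<sigma>: "\<bar>\<sigma>\<bar> = 1" "\<sigma> * Re \<mu> = \<bar>Re \<mu>\<bar>" "\<sigma> * \<sigma> = 1"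
    using \<delta> by (auto simp: \<sigma>_def sgn_real_def)
  define W where "W s = indicator {0<..} s * exp (- \<delta> * s)" for s :: real
  have m: "half_line_kernel \<mu> \<in> borel_measurable borel"
    unfolding half_line_kernel_def by measurable
  have b: "norm (half_line_kernel \<mu> s) \<le> W s" for s
  proof (cases "0 < s")
    case True
    have "norm (half_line_kernel \<mu> s) = exp (- (\<bar>Re \<mu>\<bar> * s))"
      using True \<sigma> by (simp add: half_line_kernel_def norm_mult norm_exp_eq_Re flip: \<sigma>_def)
    also have "\<dots> \<le> exp (- \<delta> * s)"
      using True \<delta> by simp
    finally show ?thesis using True by (simp add: W_def)
  qed (simp add: half_line_kernel_def W_def)
  have iW: "integrable lborel (\<lambda>s. \<bar>s * \<sigma>\<bar> ^ \<gamma> * W s)" for \<gamma>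
    using integrable_power_exp[OF \<delta>(1)] by (simp add: abs_mult \<sigma> W_def)
  note c = schwartz_convolve[OF f m b iW] mixed_convolve[OF f m b iW]
      schwartz_norm_convolve[OF f m b iW]
  show "g \<in> schwartz" unfolding g_def \<sigma>_def[symmetric] by (rule c)
  show mx: "mixed \<alpha> \<beta> g = convolve 0 (sgn (Re \<mu>)) (half_line_kernel \<mu>) (mixed \<alpha> \<beta> f)" for \<alpha> \<beta>
    unfolding g_def \<sigma>_def[symmetric] by (rule c)
  show "schwartz_norm \<alpha> \<beta> \<gamma> g \<le>
      2 ^ \<gamma> * ((\<integral>s. indicator {0<..} s * exp (- \<delta> * s) \<partial>lborel) * schwartz_norm \<alpha> \<beta> \<gamma> f +
        (\<integral>s. \<bar>s\<bar> ^ \<gamma> * (indicator {0<..} s * exp (- \<delta> * s)) \<partial>lborel) * schwartz_norm \<alpha> \<beta> 0 f)"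
    unfolding g_def \<sigma>_def[symmetric]
    using c(3)[of \<alpha> \<beta> \<gamma> 0] by (simp add: abs_mult \<sigma> W_def)
  obtain t x where z: "z = (t, x)" by force
  define E where "E s = exp (- (\<sigma> * \<mu>) * of_real s)" for s :: real
  define F where "F s = E s * f (t, x - s * \<sigma>)" for s
  define F' where "F' s = - \<sigma> * (E s * (partial_x f (t, x - s * \<sigma>) + \<mu> * f (t, x - s * \<sigma>)))" for s
  have dE: "(E has_vector_derivative - (\<sigma> * \<mu>) * E s) (at s)" for s
  proof -
    have "((\<lambda>w. exp (- (\<sigma> * \<mu>) * w)) has_field_derivative - (\<sigma> * \<mu>) * E s) (at (of_real s))"
      unfolding E_def by (auto intro!: derivative_eq_intros)
    from has_vector_derivative_real_field[OF this] show ?thesis unfolding E_def .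
  qed
  have dF: "(F has_vector_derivative F' s) (at s)" for s
  proof -
    have "((\<lambda>y. f (t, y)) \<circ> (\<lambda>s. x - s * \<sigma>) has_vector_derivative (-\<sigma>) *\<^sub>R partial_x f (t, x - s
        * \<sigma>)) (at s)"
      by (rule vector_diff_chain_at[OF _ smooth_deriv_x[OF schwartz_smooth[OF f]]])
        (auto intro!: derivative_eq_intros)
    from has_vector_derivative_mult[OF dE this] show ?thesis
      unfolding F_def F'_def by (simp add: o_def scaleR_conv_of_real algebra_simps)
  qed
  have px: "partial_x f = mixed 0 (Suc 0) f" by (simp add: mixed_def)
  have cont: "continuous_on UNIV (\<lambda>s. h (t, x - s * \<sigma>))" if "continuous_on UNIV h" for h :: cfun
    by (rule continuous_on_compose2[OF that]) (auto intro!: continuous_intros)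
  have cF': "continuous_on UNIV F'"
    unfolding F'_def E_def px
    by (intro continuous_intros cont schwartz_mixed_continuous[OF f]
        smooth_continuous_on[OF schwartz_smooth[OF f]])
  have i0: "integrable lborel (\<lambda>s. half_line_kernel \<mu> s * mixed 0 \<beta> f (t, x - s * \<sigma>))" for \<beta>
  proof -
    have "mixed 0 \<beta> f \<in> schwartz"
    proof (induction \<beta>)
      case (Suc \<beta>)
      then show ?case
        using schwartz_partial_x[OF Suc] partial_x_mixed[OF schwartz_smooth[OF f], of 0 \<beta>] by simp
    qed (simp add: f)
    from integrable_convolve[OF this m b iW, of t 0 x] show ?thesis by simp
  qed
  have k: "- (indicator {0<..} s *\<^sub>R F' s) =
      half_line_kernel \<mu> s * mixed 0 (Suc 0) f (t, x - s * \<sigma>) +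
      \<mu> * (half_line_kernel \<mu> s * mixed 0 0 f (t, x - s * \<sigma>))" for s
    by (simp add: half_line_kernel_def F'_def E_def px indicator_def algebra_simps flip: \<sigma>_def)
  have "integrable lborel (\<lambda>s. - (indicator {0<..} s *\<^sub>R F' s))"
    unfolding k by (intro Bochner_Integration.integrable_add integrable_mult_right i0)
  then have iF: "integrable lborel (\<lambda>s. indicator {0<..} s *\<^sub>R F' s)"
    using Bochner_Integration.integrable_minus by fastforce
  have "(LBINT s=0..\<infinity>. F' s) = 0 - F 0"
  proof (rule interval_integral_FTC_integrable)
    show "set_integrable lborel (einterval 0 \<infinity>) F'"
      using iF by (simp add: set_integrable_def zero_ereal_def)
    show "isCont F' s" for s
      using cF' by (simp add: continuous_on_eq_continuous_at)
    show "((F \<circ> real_of_ereal) \<longlongrightarrow> F 0) (at_right 0)"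
    proof -
      have "isCont F 0" using dF[of 0] by (rule has_vector_derivative_continuous)
      then have "(F \<longlongrightarrow> F 0) (at_right 0)"
        by (simp add: isCont_def filterlim_at_split)
      then show ?thesis by (simp add: zero_ereal_def ereal_tendsto_simps)
    qed
    have "(F \<longlongrightarrow> 0) at_top"
    proof (rule Lim_null_comparison)
      have "norm (F s) \<le> schwartz_norm 0 0 0 f * exp (- \<delta> * s)" if s: "0 \<le> s" for s
      proof -
        have "norm (E s) = exp (- (\<bar>Re \<mu>\<bar> * s))"
          by (simp add: E_def norm_exp_eq_Re \<sigma>(2))
        also have "\<dots> \<le> exp (- \<delta> * s)"
          using \<delta> s by (simp add: mult_right_mono)
        finally have "norm (E s) \<le> exp (- \<delta> * s)" .
        moreover have "norm (f (t, x - s * \<sigma>)) \<le> schwartz_norm 0 0 0 f"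
          using schwartz_mixed_bound[OF f, of "x - s * \<sigma>" 0 0 0 t] by simp
        ultimately show ?thesis
          unfolding F_def norm_mult mult.commute[of "norm (E s)"]
          by (intro mult_mono) (auto simp: schwartz_norm_nonneg[OF f])
      qed
      then show "\<forall>\<^sub>F s in at_top. norm (F s) \<le> schwartz_norm 0 0 0 f * exp (- \<delta> * s)"
        by (auto intro: eventually_at_top_linorderI[of 0])
      have "((\<lambda>s. exp (- \<delta> * s)) \<longlongrightarrow> 0) at_top"
        using \<delta>(1)
        by (auto intro!: exp_at_bot[THEN filterlim_compose] filterlim_tendsto_pos_mult_at_top
            filterlim_ident simp: filterlim_uminus_at_bot)
      then show "((\<lambda>s. schwartz_norm 0 0 0 f * exp (- \<delta> * s)) \<longlongrightarrow> 0) at_top"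
        by (rule tendsto_mult_right_zero)
    qed
    then show "((F \<circ> real_of_ereal) \<longlongrightarrow> 0) (at_left \<infinity>)"
      by (simp add: ereal_tendsto_simps)
  qed (auto intro: dF)
  then have "f z = - (\<integral>s. indicator {0<..} s *\<^sub>R F' s \<partial>lborel)"
    by (simp add: interval_lebesgue_integral_def set_lebesgue_integral_def zero_ereal_def F_def E_def z)
  also have "\<dots> = (\<integral>s. - (indicator {0<..} s *\<^sub>R F' s) \<partial>lborel)" by simp
  also have "\<dots> = convolve 0 \<sigma> (half_line_kernel \<mu>) (mixed 0 (Suc 0) f) z + \<mu> * g z"
    unfolding k g_def \<sigma>_def[symmetric] convolve_def z
    using i0[of "Suc 0"] i0[of 0] by simp
  also have "convolve 0 \<sigma> (half_line_kernel \<mu>) (mixed 0 (Suc 0) f) z = partial_x g z"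
    using mx[of 0 "Suc 0"] by (simp add: mixed_def \<sigma>_def)
  finally show "partial_x g z + \<mu> * g z = f z" by simp
qed

section \<open>Solvability in the Schwartz space\<close>

text \<open>On the \<open>k\<close>-th mode the operator is \<open>c\<^sub>x (\<partial>\<^sub>x + \<mu>\<^sub>k)\<close>. The half-line solution of a mode
  is again a multiple of \<open>e\<^bsup>ikt\<^esup>\<close> because convolution in \<open>x\<close> commutes with \<open>\<partial>\<^sub>t\<close>.\<close>

lemma solvable_if_modes_hyperbolic:
  assumes f: "f \<in> schwartz" and cx: "cx \<noteq> 0" and \<delta>: "0 < \<delta>"
    and k: "\<And>k. \<delta> \<le> \<bar>Re ((\<i> * of_int k * ct + q) / cx)\<bar>"
  shows "\<exists>g\<in>schwartz. apply_op ct cx q g = f"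
proof (rule solvable_of_modes[OF f])
  define \<mu> where "\<mu> k = (\<i> * of_int k * ct + q) / cx" for k :: int
  define H where "H k = convolve 0 (sgn (Re (\<mu> k))) (half_line_kernel (\<mu> k)) (fourier_mode k f)"
      for k
  define G where "G k = (\<lambda>z. 1 / cx * H k z)" for k
  have \<mu>: "\<delta> \<le> \<bar>Re (\<mu> k)\<bar>" for k unfolding \<mu>_def by (rule k)
  note P = schwartz_fourier_mode[OF f]
  have H: "H k \<in> schwartz" for k
    unfolding H_def by (rule schwartz_half_line[OF \<delta> \<mu> P])
  show G: "G k \<in> schwartz" for k
    unfolding G_def by (rule schwartz_mult_left[OF H])
  have mx: "mixed \<alpha> \<beta> (G k) = (\<lambda>z. 1 / cx * mixed \<alpha> \<beta> (H k) z)" for \<alpha> \<beta> k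
    unfolding G_def by (rule mixed_mult_left[OF H])
  show "\<exists>C. \<forall>k. schwartz_norm \<alpha> \<beta> \<gamma> (G k) \<le> C * inverse (1 + (of_int k)\<^sup>2)" for \<alpha> \<beta> \<gamma>
  proof -
    obtain C1 C2 where C1: "\<And>k. schwartz_norm \<alpha> \<beta> \<gamma> (fourier_mode k f) \<le> C1 * inverse (1
        + (of_int k)\<^sup>2)"
      and C2: "\<And>k. schwartz_norm \<alpha> \<beta> 0 (fourier_mode k f) \<le> C2 * inverse (1 + (of_int k)\<^sup>2)"
      using fourier_mode_decay[OF f] by metis
    define I where "I = (\<integral>s. indicator {0<..} s * exp (- \<delta> * s) \<partial>lborel)"
    define J where "J = (\<integral>s. \<bar>s\<bar> ^ \<gamma> * (indicator {0<..} s * exp (- \<delta> * s)) \<partial>lborel)"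
    have I0: "0 \<le> I" "0 \<le> J" unfolding I_def J_def by simp_all
    define C where "C = norm (1 / cx) * (2 ^ \<gamma> * (I * C1 + J * C2))"
    have "schwartz_norm \<alpha> \<beta> \<gamma> (G k) \<le> C * inverse (1 + (of_int k)\<^sup>2)" for k
    proof (rule schwartz_norm_leI)
      fix t x
      have "schwartz_norm \<alpha> \<beta> \<gamma> (H k) \<le> 2 ^ \<gamma> *
          (I * schwartz_norm \<alpha> \<beta> \<gamma> (fourier_mode k f) + J * schwartz_norm \<alpha> \<beta> 0 (fourier_mode k f))"
        unfolding H_def I_def J_def by (rule schwartz_norm_half_line[OF \<delta> \<mu> P])
      also have "\<dots> \<le> 2 ^ \<gamma> * (I * (C1 * inverse (1 + (of_int k)\<^sup>2)) + J * (C2 * inverse (1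
          + (of_int k)\<^sup>2)))"
        using I0 by (intro mult_left_mono add_mono C1 C2) auto
      finally have le: "\<bar>x\<bar> ^ \<gamma> * norm (mixed \<alpha> \<beta> (H k) (t, x)) \<le>
          2 ^ \<gamma> * (I * (C1 * inverse (1 + (of_int k)\<^sup>2)) + J * (C2 * inverse (1 + (of_int k)\<^sup>2)))"
        by (rule order_trans[OF schwartz_mixed_bound[OF H]])
      have "\<bar>x\<bar> ^ \<gamma> * norm (mixed \<alpha> \<beta> (G k) (t, x)) =
          norm (1 / cx) * (\<bar>x\<bar> ^ \<gamma> * norm (mixed \<alpha> \<beta> (H k) (t, x)))"
        unfolding mx norm_mult by simp
      also have "\<dots> \<le> norm (1 / cx) *
          (2 ^ \<gamma> * (I * (C1 * inverse (1 + (of_int k)\<^sup>2)) + J * (C2 * inverse (1 + (of_int k)\<^sup>2))))"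
        by (rule mult_left_mono[OF le norm_ge_zero])
      also have "\<dots> = C * inverse (1 + (of_int k)\<^sup>2)"
        by (simp add: C_def algebra_simps)
      finally show "\<bar>x\<bar> ^ \<gamma> * norm (mixed \<alpha> \<beta> (G k) (t, x)) \<le> C * inverse (1 + (of_int k)\<^sup>2)" .
    qed
    then show ?thesis by blast
  qed
  show "apply_op ct cx q (G k) = fourier_mode k f" for k
  proof
    fix z
    have px: "partial_x (G k) z = 1 / cx * partial_x (H k) z"
      using mx[of 0 "Suc 0" k] by (simp add: mixed_def)
    have "mixed (Suc 0) 0 (H k) = convolve 0 (sgn (Re (\<mu> k))) (half_line_kernel (\<mu> k)) (mixed (Suc 0) 0 (fourier_mode k f))"
      unfolding H_def by (rule mixed_half_line[OF \<delta> \<mu> P])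
    also have "mixed (Suc 0) 0 (fourier_mode k f) = (\<lambda>z. \<i> * of_int k * fourier_mode k f z)"
      using partial_t_fourier_mode[OF f, of k] by (simp add: mixed_def)
    also have "convolve 0 v2 w (\<lambda>z. c * h z) = (\<lambda>z. c * convolve 0 v2 w h z)" for v2 w c h
      unfolding convolve_def by (auto simp: mult.left_commute)
    finally have "partial_t (H k) = (\<lambda>z. \<i> * of_int k * H k z)"
      by (simp add: mixed_def H_def)
    then have pt: "partial_t (G k) z = 1 / cx * (\<i> * of_int k * H k z)"
      using mx[of "Suc 0" 0 k] by (simp add: mixed_def)
    have "apply_op ct cx q (G k) z = partial_x (H k) z + \<mu> k * H k z"
      unfolding apply_op_def px pt using cx by (simp add: G_def \<mu>_def field_simps)
    then show "apply_op ct cx q (G k) z = fourier_mode k f z"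
      using half_line_solves[OF \<delta> \<mu> P, of k k z] by (simp add: H_def)
  qed
qed

text \<open>Without \<open>\<partial>\<^sub>x\<close> the operator multiplies the \<open>k\<close>-th mode by the number \<open>i k c\<^sub>t + q\<close>.\<close>

lemma solvable_without_x_derivative:
  assumes f: "f \<in> schwartz" and \<delta>: "0 < \<delta>" and k: "\<And>k. \<delta> \<le> norm (\<i> * of_int k * ct + q)"
  shows "\<exists>g\<in>schwartz. apply_op ct 0 q g = f"
proof (rule solvable_of_modes[OF f])
  define m where "m k = 1 / (\<i> * of_int k * ct + q)" for k :: int
  have nz: "\<i> * of_int k * ct + q \<noteq> 0" for k :: int using k[of k] \<delta> by auto
  have m: "norm (m k) \<le> 1 / \<delta>" for k
    unfolding m_def norm_divide using k[of k] \<delta> by (simp add: frac_le)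
  define G where "G k = (\<lambda>z. m k * fourier_mode k f z)" for k
  note P = schwartz_fourier_mode[OF f]
  show G: "G k \<in> schwartz" for k
    unfolding G_def by (rule schwartz_mult_left[OF P])
  have mx: "mixed \<alpha> \<beta> (G k) = (\<lambda>z. m k * mixed \<alpha> \<beta> (fourier_mode k f) z)" for \<alpha> \<beta> k
    unfolding G_def by (rule mixed_mult_left[OF P])
  show "\<exists>C. \<forall>k. schwartz_norm \<alpha> \<beta> \<gamma> (G k) \<le> C * inverse (1 + (of_int k)\<^sup>2)" for \<alpha> \<beta> \<gamma>
  proof -
    obtain C where C: "\<And>k. schwartz_norm \<alpha> \<beta> \<gamma> (fourier_mode k f) \<le> C * inverse (1 + (of_int k)\<^sup>2)"
      using fourier_mode_decay[OF f] by metis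
    have "schwartz_norm \<alpha> \<beta> \<gamma> (G k) \<le> (1 / \<delta> * C) * inverse (1 + (of_int k)\<^sup>2)" for k
    proof (rule schwartz_norm_leI)
      fix t x
      have "\<bar>x\<bar> ^ \<gamma> * norm (mixed \<alpha> \<beta> (G k) (t, x)) =
          norm (m k) * (\<bar>x\<bar> ^ \<gamma> * norm (mixed \<alpha> \<beta> (fourier_mode k f) (t, x)))"
        unfolding mx norm_mult by simp
      also have "\<dots> \<le> 1 / \<delta> * (C * inverse (1 + (of_int k)\<^sup>2))"
        using \<delta> by (intro mult_mono m order_trans[OF schwartz_mixed_bound[OF P] C]) auto
      finally show "\<bar>x\<bar> ^ \<gamma> * norm (mixed \<alpha> \<beta> (G k) (t, x)) \<le> (1 / \<delta> * C) * inverse (1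
          + (of_int k)\<^sup>2)"
        by (simp add: mult.assoc)
    qed
    then show ?thesis by blast
  qed
  show "apply_op ct 0 q (G k) = fourier_mode k f" for k
  proof
    fix z
    have "partial_t (G k) z = m k * (\<i> * of_int k * fourier_mode k f z)"
      using mx[of "Suc 0" 0 k] partial_t_fourier_mode[OF f, of k] by (simp add: mixed_def)
    then have "apply_op ct 0 q (G k) z = m k * (\<i> * of_int k * ct + q) * fourier_mode k f z"
      by (simp add: apply_op_def G_def algebra_simps)
    then show "apply_op ct 0 q (G k) z = fourier_mode k f z"
      using nz[of k] by (simp add: m_def)
  qed
qed

section \<open>Hypoellipticity by duality\<close>

lemma first_order_op_tempered:
  assumes u: "u \<in> tempered_distributions" and f: "f \<in> schwartz"
  shows "first_order_op ct cx q u f = u (apply_op (- ct) (- cx) q f)"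
proof -
  have a: "u (\<lambda>z. g z + h z) = u g + u h" if "g \<in> schwartz" "h \<in> schwartz" for g h
    using u that by (auto simp: tempered_distributions_def)
  have m: "u (\<lambda>z. c * g z) = c * u g" if "g \<in> schwartz" for c g
    using u that by (auto simp: tempered_distributions_def)
  note S = schwartz_partial_t[OF f] schwartz_partial_x[OF f] f
  show ?thesis
    unfolding apply_op_def first_order_op_def dist_partial_t_def dist_partial_x_def
    by (simp only: a m S schwartz_add schwartz_mult_left) simp
qed

lemma dist_of_fun_transpose:
  assumes g: "bounded_C1 g gt gx" and f: "f \<in> schwartz"
  shows "dist_of_fun g (apply_op (- ct) (- cx) q f) =
    dist_of_fun (\<lambda>z. ct * gt z + cx * gx z + q * g z) f"
proof -
  obtain B where B: "\<And>z. norm (g z) \<le> B" "\<And>z. norm (gt z) \<le> B" "\<And>z. norm (gx z) \<le> B"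
    using g unfolding bounded_C1_def by blast
  have c: "continuous_on UNIV g" "continuous_on UNIV gt" "continuous_on UNIV gx"
    using g unfolding bounded_C1_def by blast+
  note S = schwartz_partial_t[OF f] schwartz_partial_x[OF f] f
  have "dist_of_fun g (apply_op (- ct) (- cx) q f) =
      - ct * dist_of_fun g (partial_t f) + - cx * dist_of_fun g (partial_x f) + q * dist_of_fun g f"
    unfolding apply_op_def
    by (simp only: dist_of_fun_add[OF c(1) B(1)] dist_of_fun_mult S schwartz_add schwartz_mult_left)
  also have "\<dots> = ct * dist_of_fun gt f + cx * dist_of_fun gx f + q * dist_of_fun g f"
    by (simp add: dist_of_fun_partial_t[OF g f] dist_of_fun_partial_x[OF g f])
  also have "\<dots> = (LINT z:strip|lborel. ct * (gt z * f z) + cx * (gx z * f z) + q * (g z * f z))"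
    unfolding dist_of_fun_def
    by (subst set_integral_add(2); (intro set_integral_add(1) set_integrable_mult_right
          dist_of_fun_integrable[OF c(1) B(1) f] dist_of_fun_integrable[OF c(2) B(2) f]
          dist_of_fun_integrable[OF c(3) B(3) f])?)+ simp
  also have "\<dots> = dist_of_fun (\<lambda>z. ct * gt z + cx * gx z + q * g z) f"
    unfolding dist_of_fun_def by (simp add: algebra_simps)
  finally show ?thesis .
qed

text \<open>If \<open>L g\<close> is the Schwartz function \<open>L u\<close> and \<open>\<phi> = L\<^sup>t \<psi>\<close>, then
  \<open>u(\<phi>) = (L u)(\<psi>) = \<integral> (L g) \<psi> = \<integral> g \<phi>\<close>.\<close>

lemma hypoelliptic_if_solvable:
  assumes L: "\<And>f. f \<in> schwartz \<Longrightarrow> \<exists>g\<in>schwartz. apply_op ct cx q g = f"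
    and Lt: "\<And>f. f \<in> schwartz \<Longrightarrow> \<exists>g\<in>schwartz. apply_op (- ct) (- cx) q g = f"
  shows "schwartz_globally_hypoelliptic (first_order_op ct cx q)"
  unfolding schwartz_globally_hypoelliptic_def
proof (intro ballI impI)
  fix u assume u: "u \<in> tempered_distributions" and "is_schwartz (first_order_op ct cx q u)"
  then obtain f where f: "f \<in> schwartz"
    and uf: "\<And>\<phi>. \<phi> \<in> schwartz \<Longrightarrow> first_order_op ct cx q u \<phi> = dist_of_fun f \<phi>"
    unfolding is_schwartz_def by blast
  obtain g where g: "g \<in> schwartz" "apply_op ct cx q g = f" using L[OF f] by blast
  have "u \<phi> = dist_of_fun g \<phi>" if \<phi>: "\<phi> \<in> schwartz" for \<phi>
  proof -
    obtain \<psi> where \<psi>: "\<psi> \<in> schwartz" "apply_op (- ct) (- cx) q \<psi> = \<phi>" using Lt[OF \<phi>] by blast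
    have "u \<phi> = dist_of_fun f \<psi>"
      using first_order_op_tempered[OF u \<psi>(1)] uf[OF \<psi>(1)] \<psi>(2) by simp
    also have "f = (\<lambda>z. ct * partial_t g z + cx * partial_x g z + q * g z)"
      using g(2) by (simp add: apply_op_def)
    also have "dist_of_fun \<dots> \<psi> = dist_of_fun g \<phi>"
      using dist_of_fun_transpose[OF bounded_C1_schwartz[OF g(1)] \<psi>(1), of ct cx q] unfolding \<psi>(2)
          by (rule sym)
    finally show ?thesis .
  qed
  with g(1) show "is_schwartz u" unfolding is_schwartz_def by blast
qed

text \<open>The transpose satisfies the same bound, since replacing \<open>(c\<^sub>t, c\<^sub>x)\<close> by its negative
  changes \<open>\<mu>\<^sub>k\<close> into \<open>- \<mu>\<^sub>-\<^sub>k\<close>.\<close>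

lemma hypoelliptic_if_modes_hyperbolic:
  assumes cx: "cx \<noteq> 0" and \<delta>: "0 < \<delta>"
    and k: "\<And>k. \<delta> \<le> \<bar>Re ((\<i> * of_int k * ct + q) / cx)\<bar>"
  shows "schwartz_globally_hypoelliptic (first_order_op ct cx q)"
proof (rule hypoelliptic_if_solvable)
  fix f assume f: "f \<in> schwartz"
  show "\<exists>g\<in>schwartz. apply_op ct cx q g = f"
    by (rule solvable_if_modes_hyperbolic[OF f cx \<delta> k])
  have "\<delta> \<le> \<bar>Re ((\<i> * of_int k * (- ct) + q) / (- cx))\<bar>" for k
    using k[of "- k"] by simp
  then show "\<exists>g\<in>schwartz. apply_op (- ct) (- cx) q g = f"
    using cx by (intro solvable_if_modes_hyperbolic[OF f _ \<delta>]) auto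
qed

lemma hypoelliptic_without_x_derivative:
  assumes \<delta>: "0 < \<delta>" and k: "\<And>k. \<delta> \<le> norm (\<i> * of_int k * ct + q)"
  shows "schwartz_globally_hypoelliptic (first_order_op ct 0 q)"
proof (rule hypoelliptic_if_solvable)
  fix f assume f: "f \<in> schwartz"
  show "\<exists>g\<in>schwartz. apply_op ct 0 q g = f"
    by (rule solvable_without_x_derivative[OF f \<delta> k])
  have "\<delta> \<le> norm (\<i> * of_int k * (- ct) + q)" for k
    using k[of "- k"] by simp
  then show "\<exists>g\<in>schwartz. apply_op (- ct) (- 0) q g = f"
    using solvable_without_x_derivative[OF f \<delta>] by simp
qed

section \<open>Bounded functions as tempered distributions\<close>

lemma schwartz_zero: "(\<lambda>z. 0) \<in> schwartz"
proof (rule schwartz_family(1)[of "\<lambda>_ _ _. 0"])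
  show "\<exists>C. \<forall>t x::real. \<bar>x\<bar> ^ \<gamma> * norm (0::complex) \<le> C" for \<gamma>
    by (intro exI[of _ 0]) simp
qed (simp_all add: periodic_t_def)

lemma schwartz_norm_zero: "schwartz_norm \<alpha> \<beta> \<gamma> (\<lambda>z. 0) = 0"
proof -
  have "mixed \<alpha> \<beta> (\<lambda>z. 0) = (\<lambda>z. 0)"
    using mixed_mult_left[OF schwartz_zero, of \<alpha> \<beta> 0] by simp
  then have "schwartz_norm \<alpha> \<beta> \<gamma> (\<lambda>z. 0) \<le> 0" by (intro schwartz_norm_leI) simp
  then show ?thesis using schwartz_norm_nonneg[OF schwartz_zero, of \<alpha> \<beta> \<gamma>] by simp
qed

lemma decay_const_le_seminorm:
  assumes f: "f \<in> schwartz"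
  shows "decay_const 0 0 f \<le> schwartz_seminorm 2 f"
proof -
  let ?I = "{(\<alpha>, \<beta>, \<gamma>). \<alpha> + \<beta> + \<gamma> \<le> (2::nat)}"
  have "finite ?I"
    by (rule finite_subset[of _ "{..2} \<times> {..2} \<times> {..2}"]) auto
  then have "(\<Sum>(\<alpha>, \<beta>, \<gamma>)\<in>{(0, 0, 0), (0, 0, 2)}. schwartz_norm \<alpha> \<beta> \<gamma> f) \<le> schwartz_seminorm 2 f"
    unfolding schwartz_seminorm_def
    by (rule sum_mono2) (use schwartz_norm_nonneg[OF f] in auto)
  then show ?thesis by (simp add: decay_const_def)
qed

lemma openin_seminorm_ball:
  assumes "f \<in> schwartz" "0 < \<epsilon>"
  shows "openin schwartz_topology {g \<in> schwartz. schwartz_seminorm N (\<lambda>z. g z - f z) < \<epsilon>}"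
  unfolding schwartz_topology_def by (rule topology_generated_by_Basis) (use assms in blast)

lemma topspace_schwartz_topology: "topspace schwartz_topology = schwartz"
proof -
  have "f \<in> topspace schwartz_topology" if f: "f \<in> schwartz" for f
  proof -
    have "f \<in> {g \<in> schwartz. schwartz_seminorm 0 (\<lambda>z. g z - f z) < 1}"
      using f by (simp add: schwartz_seminorm_def schwartz_norm_zero case_prod_beta)
    then show ?thesis
      using openin_subset[OF openin_seminorm_ball[OF f zero_less_one]] by blast
  qed
  moreover have "topspace schwartz_topology \<subseteq> schwartz"
    unfolding schwartz_topology_def topology_generated_by_topspace by blast
  ultimately show ?thesis by blast
qed

text \<open>The functional is bounded by a multiple of the single seminorm of order two, which
  already provides the integrable weight \<open>1 / (1 + x\<^sup>2)\<close>; by linearity it is continuous.\<close>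

lemma dist_of_fun_tempered:
  assumes g: "continuous_on UNIV g" "\<And>z. norm (g z) \<le> B"
  shows "dist_of_fun g \<in> tempered_distributions"
proof -
  have B: "0 \<le> B" using order_trans[OF norm_ge_zero g(2)] .
  define K where "K = B * (\<integral>z. indicator strip z * inverse (1 + (snd z)\<^sup>2) \<partial>lborel)"
  have K: "0 \<le> K" unfolding K_def
      by (intro mult_nonneg_nonneg B integral_nonneg) (simp add: add_nonneg_nonneg)
  have bound: "norm (dist_of_fun g f) \<le> K * schwartz_seminorm 2 f" if f: "f \<in> schwartz" for f
  proof -
    have "norm (LINT z:strip|lborel. g z * f z) \<le>
        (B * decay_const 0 0 f) * (\<integral>z. indicator strip z * inverse (1 + (snd z)\<^sup>2) \<partial>lborel)"
    proof (rule norm_strip_integral)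
      show "continuous_on UNIV (\<lambda>z. g z * f z)"
        by (intro continuous_intros g smooth_continuous_on schwartz_smooth f)
      show "norm (g (t, x) * f (t, x)) \<le> B * decay_const 0 0 f * inverse (1 + x\<^sup>2)" for t x
        using bounded_mult_schwartz_decay[of g B f t x 0 0, OF g(2) f] by simp
    qed
    also have "\<dots> = K * decay_const 0 0 f" by (simp add: K_def)
    also have "\<dots> \<le> K * schwartz_seminorm 2 f"
      by (intro mult_left_mono decay_const_le_seminorm f K)
    finally show ?thesis by (simp add: dist_of_fun_def)
  qed
  have diff: "dist_of_fun g f - dist_of_fun g h = dist_of_fun g (\<lambda>z. f z - h z)"
    if f: "f \<in> schwartz" and h: "h \<in> schwartz" for f h
    using dist_of_fun_add[OF g f schwartz_mult_left[OF h, of "-1"]] dist_of_fun_mult[of g "-1" h]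
        by simp
  have "continuous_map schwartz_topology euclidean (dist_of_fun g)"
    unfolding continuous_map topspace_schwartz_topology
  proof (intro conjI allI impI)
    fix U :: "complex set" assume "openin euclidean U"
    then have U: "open U" by simp
    show "openin schwartz_topology {f \<in> schwartz. dist_of_fun g f \<in> U}"
    proof (subst openin_subopen, intro ballI)
      fix f assume "f \<in> {f \<in> schwartz. dist_of_fun g f \<in> U}"
      then have f: "f \<in> schwartz" and fU: "dist_of_fun g f \<in> U" by auto
      obtain e where e: "0 < e" "ball (dist_of_fun g f) e \<subseteq> U" using U fU openE by blast
      let ?B = "{h \<in> schwartz. schwartz_seminorm 2 (\<lambda>z. h z - f z) < e / (K + 1)}"
      have e': "0 < e / (K + 1)" using e K by simp
      have "f \<in> ?B"
        using f e' by (simp add: schwartz_seminorm_def schwartz_norm_zero case_prod_beta)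
      moreover have "?B \<subseteq> {f \<in> schwartz. dist_of_fun g f \<in> U}"
      proof
        fix h assume h: "h \<in> ?B"
        let ?s = "schwartz_seminorm 2 (\<lambda>z. h z - f z)"
        have hf: "(\<lambda>z. h z - f z) \<in> schwartz" using h f schwartz_diff by blast
        have s0: "0 \<le> ?s"
          using order_trans[OF decay_const_nonneg decay_const_le_seminorm] hf by blast
        have "norm (dist_of_fun g h - dist_of_fun g f) \<le> K * ?s"
          using h diff[of h f] f bound[OF hf] by simp
        also have "\<dots> \<le> (K + 1) * ?s" using s0 by (simp add: mult_right_mono)
        also have "\<dots> < (K + 1) * (e / (K + 1))"
          using h K by (intro mult_strict_left_mono) auto
        also have "\<dots> = e" using K by simp
        finally have "dist_of_fun g h \<in> ball (dist_of_fun g f) e"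
          by (simp add: dist_norm norm_minus_commute)
        then show "h \<in> {f \<in> schwartz. dist_of_fun g f \<in> U}" using h e by auto
      qed
      ultimately show "\<exists>T. openin schwartz_topology T \<and> f \<in> T
          \<and> T \<subseteq> {f \<in> schwartz. dist_of_fun g f \<in> U}"
        using openin_seminorm_ball[OF f e'] by blast
    qed
  qed simp
  then show ?thesis
    unfolding tempered_distributions_def using dist_of_fun_add[OF g] dist_of_fun_mult by auto
qed

section \<open>Plane waves and Gaussian wave packets\<close>

definition plane_wave :: "int \<Rightarrow> real \<Rightarrow> cfun" where
  "plane_wave k \<xi> = (\<lambda>(t, x). wave k t * exp (\<i> * of_real \<xi> * of_real x))"

lemma norm_plane_wave [simp]: "norm (plane_wave k \<xi> z) = 1"
  by (simp add: plane_wave_def norm_mult norm_exp_eq_Re case_prod_beta)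

lemma plane_wave_add: "plane_wave k \<xi> (t, x + y) = exp (\<i> * of_real \<xi> * of_real y)
    * plane_wave k \<xi> (t, x)"
  by (simp add: plane_wave_def algebra_simps flip: exp_add)

lemma continuous_on_plane_wave: "continuous_on UNIV (plane_wave k \<xi>)"
  unfolding plane_wave_def case_prod_beta by (intro continuous_intros)

lemma bounded_C1_plane_wave:
  "bounded_C1 (plane_wave k \<xi>) (\<lambda>z. \<i> * of_int k * plane_wave k \<xi> z) (\<lambda>z. \<i> * of_real \<xi>
      * plane_wave k \<xi> z)"
proof -
  have "wave k (t + 2 * pi) = wave k t" for t
  proof -
    have "wave k (t + 2 * pi) = wave k t * wave k (2 * pi)"
      by (simp add: distrib_left flip: exp_add)
    then show ?thesis by (simp only: wave_2pi mult_1_right)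
  qed
  then have p: "periodic_t (plane_wave k \<xi>)"
    by (simp add: periodic_t_def plane_wave_def)
  have dt: "((\<lambda>s. plane_wave k \<xi> (s, x)) has_vector_derivative \<i> * of_int k * plane_wave k \<xi> (t,
      x)) (at t)" for t x
    using has_vector_derivative_mult_left[OF wave_deriv, of k "exp (\<i> * of_real \<xi> * of_real x)" t]
    by (simp add: plane_wave_def mult.assoc)
  have dx: "((\<lambda>y. plane_wave k \<xi> (t, y)) has_vector_derivative \<i> * of_real \<xi> * plane_wave k \<xi> (t,
      x)) (at x)" for t x
  proof -
    have "((\<lambda>w. wave k t * exp (\<i> * of_real \<xi> * w)) has_field_derivative
        \<i> * of_real \<xi> * plane_wave k \<xi> (t, x)) (at (of_real x))"
      by (auto intro!: derivative_eq_intros simp: plane_wave_def)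
    from has_vector_derivative_real_field[OF this] show ?thesis by (simp add: plane_wave_def)
  qed
  have "\<exists>B. \<forall>z. norm (plane_wave k \<xi> z) \<le> B \<and> norm (\<i> * of_int k * plane_wave k \<xi> z) \<le> B \<and>
      norm (\<i> * of_real \<xi> * plane_wave k \<xi> z) \<le> B"
    by (rule exI[of _ "max 1 (max \<bar>of_int k\<bar> \<bar>\<xi>\<bar>)"]) (auto simp: norm_mult)
  then show ?thesis
    unfolding bounded_C1_def using p dt dx continuous_on_plane_wave
    by (auto intro!: continuous_intros continuous_on_plane_wave)
qed

text \<open>Induction on the polynomial with the power \<open>\<gamma>\<close> arbitrary, because the factor \<open>x\<close> that
  \<open>pCons\<close> brings is absorbed into that power.\<close>

lemma poly_gaussian_bounded:
  "\<exists>C. \<forall>x::real. \<bar>x\<bar> ^ \<gamma> * (norm (poly p (of_real x :: complex)) * exp (- x\<^sup>2)) \<le> C"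
proof (induction p arbitrary: \<gamma>)
  case 0
  then show ?case by auto
next
  case (pCons a p)
  obtain C where C: "\<bar>x\<bar> ^ Suc \<gamma> * (norm (poly p (of_real x :: complex)) * exp (- x\<^sup>2)) \<le> C"
      for x :: real
    using pCons.IH by blast
  have mon: "\<bar>x\<bar> ^ \<gamma> * exp (- x\<^sup>2) \<le> 1 + fact \<gamma>" for x :: real
  proof -
    have "\<bar>x\<bar> ^ \<gamma> \<le> 1 + (x\<^sup>2) ^ \<gamma>"
    proof (cases "\<bar>x\<bar> \<le> 1")
      case True
      then show ?thesis using power_le_one[of "\<bar>x\<bar>" \<gamma>] by (simp add: add_increasing2)
    next
      case False
      then have "\<bar>x\<bar> * 1 \<le> \<bar>x\<bar> * \<bar>x\<bar>" by (intro mult_left_mono) auto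
      then have "\<bar>x\<bar> ^ \<gamma> \<le> (x\<^sup>2) ^ \<gamma>"
        by (intro power_mono) (auto simp: power2_eq_square)
      then show ?thesis by simp
    qed
    also have "\<dots> \<le> exp (x\<^sup>2) + fact \<gamma> * exp (x\<^sup>2)"
      by (intro add_mono power_le_fact_mult_exp) auto
    finally have "\<bar>x\<bar> ^ \<gamma> \<le> (1 + fact \<gamma>) * exp (x\<^sup>2)" by (simp add: algebra_simps)
    then show ?thesis by (simp add: exp_minus field_simps)
  qed
  have "\<bar>x\<bar> ^ \<gamma> * (norm (poly (pCons a p) (of_real x)) * exp (- x\<^sup>2)) \<le> norm a * (1 + fact \<gamma>) + C"
      for x :: real
  proof -
    have "norm (poly (pCons a p) (of_real x)) \<le> norm a + \<bar>x\<bar> * norm (poly p (of_real x))"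
      using norm_triangle_ineq[of a "of_real x * poly p (of_real x)"] by (simp add: norm_mult)
    then have "\<bar>x\<bar> ^ \<gamma> * (norm (poly (pCons a p) (of_real x)) * exp (- x\<^sup>2)) \<le>
        \<bar>x\<bar> ^ \<gamma> * ((norm a + \<bar>x\<bar> * norm (poly p (of_real x))) * exp (- x\<^sup>2))"
      by (intro mult_left_mono mult_right_mono) auto
    also have "\<dots> = norm a * (\<bar>x\<bar> ^ \<gamma> * exp (- x\<^sup>2)) +
        \<bar>x\<bar> ^ Suc \<gamma> * (norm (poly p (of_real x)) * exp (- x\<^sup>2))"
      by (simp add: algebra_simps)
    also have "\<dots> \<le> norm a * (1 + fact \<gamma>) + C"
      by (intro add_mono mult_left_mono mon C) auto
    finally show ?thesis .
  qed
  then show ?case by blast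
qed

definition wave_packet :: "int \<Rightarrow> real \<Rightarrow> cfun" where
  "wave_packet k \<xi> = (\<lambda>(t, x). plane_wave k \<xi> (t, x) * of_real (exp (- x\<^sup>2)))"

text \<open>Every \<open>x\<close>-derivative multiplies \<open>e\<^bsup>i\<xi>x - x\<^sup>2\<^esup>\<close> by a polynomial, with the recursion
  \<open>p\<^sub>\<beta>\<^sub>+\<^sub>1 = p\<^sub>\<beta>' + (i\<xi> - 2x) p\<^sub>\<beta>\<close>.\<close>

lemma schwartz_wave_packet: "wave_packet k \<xi> \<in> schwartz"
proof -
  define p where "p = rec_nat [:1:] (\<lambda>_ r. pderiv r + [:\<i> * of_real \<xi>, -2:] * r)"
  have p: "p 0 = [:1:]" "p (Suc \<beta>) = pderiv (p \<beta>) + [:\<i> * of_real \<xi>, -2:] * p \<beta>" for \<beta>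
    by (simp_all add: p_def)
  define E where "E w = exp (\<i> * of_real \<xi> * w - w\<^sup>2)" for w :: complex
  define d where "d \<alpha> \<beta> = (\<lambda>(t, x). ((\<i> * of_int k) ^ \<alpha> * wave k t) * (poly (p \<beta>) (of_real x)
      * E (of_real x)))" for \<alpha> \<beta>
  have E: "plane_wave k \<xi> (t, x) * of_real (exp (- x\<^sup>2)) = wave k t * E (of_real x)" for t x
  proof -
    have "complex_of_real (exp (- x\<^sup>2)) = exp (- (of_real x)\<^sup>2)"
      by (simp flip: exp_of_real)
    then show ?thesis
      by (simp add: plane_wave_def E_def mult.assoc add_diff_eq flip: exp_add)
  qed
  have nE: "norm (E (of_real x)) = exp (- x\<^sup>2)" for x
    by (simp add: E_def norm_exp_eq_Re flip: of_real_power)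
  have e: "d 0 0 = wave_packet k \<xi>"
    by (auto simp: d_def wave_packet_def p E)
  have per: "periodic_t (d 0 0)"
    using bounded_C1_plane_wave[of k \<xi>] unfolding e
        by (simp add: bounded_C1_def periodic_t_def wave_packet_def)
  have dt: "((\<lambda>s. d \<alpha> \<beta> (s, x)) has_vector_derivative d (Suc \<alpha>) \<beta> (t, x)) (at t)" for \<alpha> \<beta> t x
    using has_vector_derivative_mult_left[OF has_vector_derivative_mult_right[OF wave_deriv,
        of "(\<i> * of_int k) ^ \<alpha>" k],
        of "poly (p \<beta>) (of_real x) * E (of_real x)" t]
    by (simp add: d_def mult_ac)
  have dx: "((\<lambda>y. d \<alpha> \<beta> (t, y)) has_vector_derivative d \<alpha> (Suc \<beta>) (t, x)) (at x)" for \<alpha> \<beta> t x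
  proof -
    have "((\<lambda>w. ((\<i> * of_int k) ^ \<alpha> * wave k t) * (poly (p \<beta>) w * E w)) has_field_derivative
        d \<alpha> (Suc \<beta>) (t, x)) (at (of_real x))"
      unfolding E_def d_def p
      by (auto intro!: derivative_eq_intros poly_DERIV simp: algebra_simps)
    from has_vector_derivative_real_field[OF this] show ?thesis by (simp add: d_def)
  qed
  have bd: "\<exists>C. \<forall>t x. \<bar>x\<bar> ^ \<gamma> * norm (d \<alpha> \<beta> (t, x)) \<le> C" for \<alpha> \<beta> \<gamma>
  proof -
    obtain C where C: "\<And>x::real. \<bar>x\<bar> ^ \<gamma> * (norm (poly (p \<beta>) (of_real x)) * exp (- x\<^sup>2)) \<le> C"
      using poly_gaussian_bounded by blast
    have n: "\<bar>x\<bar> ^ \<gamma> * norm (d \<alpha> \<beta> (t, x)) = \<bar>of_int k\<bar> ^ \<alpha> * (\<bar>x\<bar> ^ \<gamma>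
        * (norm (poly (p \<beta>) (of_real x)) * exp (- x\<^sup>2)))" for t x
      by (simp add: d_def norm_mult norm_power nE)
    have "\<bar>x\<bar> ^ \<gamma> * norm (d \<alpha> \<beta> (t, x)) \<le> \<bar>of_int k\<bar> ^ \<alpha> * C" for t x
      unfolding n by (intro mult_left_mono C) simp
    then show ?thesis by blast
  qed
  show ?thesis using schwartz_family(1)[OF per dt dx bd] e by simp
qed

lemma plane_wave_mult_inverse: "plane_wave k \<xi> z * plane_wave (- k) (- \<xi>) z = 1"
  by (cases z) (simp add: plane_wave_def mult_ac flip: exp_add)

lemma gaussian_integral_pos: "0 < (\<integral>x. exp (- (x::real)\<^sup>2) \<partial>lborel)"
proof -
  have le: "norm (exp (- (x::real)\<^sup>2)) \<le> 1 * inverse (1 + x\<^sup>2)" for x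
  proof (rule mult_inverse_one_plus_square_ge)
    have "1 + x\<^sup>2 \<le> exp (x\<^sup>2)" by (rule exp_ge_add_one_self)
    then show "(1 + x\<^sup>2) * norm (exp (- x\<^sup>2)) \<le> 1" by (simp add: exp_minus field_simps)
  qed
  have i: "integrable lborel (\<lambda>x::real. exp (- x\<^sup>2))"
    by (rule Bochner_Integration.integrable_bound[OF integrable_mult_right[OF integrable_inverse_one_plus_square, of 1]])
      (measurable, intro AE_I2 order_trans[OF le], simp only: real_norm_def abs_ge_self)
  have "(\<integral>x. indicator {0..1::real} x * exp (-1) \<partial>lborel) \<le> (\<integral>x. exp (- (x::real)\<^sup>2) \<partial>lborel)"
  proof (rule Bochner_Integration.integral_mono[OF _ i])
    show "integrable lborel (\<lambda>x::real. indicator {0..1} x * exp (-1) :: real)"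
      by (intro integrable_mult_left) simp
    show "indicator {0..1} x * exp (-1) \<le> exp (- x\<^sup>2)" for x :: real
      by (auto simp: indicator_def power_le_one)
  qed
  then show ?thesis by (simp add: order_less_le_trans[OF exp_gt_zero])
qed

text \<open>The test functions are translates, by \<open>n\<close> in \<open>x\<close>, of the conjugate wave times a
  Gaussian. The plane wave does not see the translation except for a factor of modulus one,
  while a Schwartz function has moved out of reach by dominated convergence.\<close>

lemma plane_wave_not_schwartz: "\<not> is_schwartz (dist_of_fun (plane_wave k \<xi>))"
proof
  assume "is_schwartz (dist_of_fun (plane_wave k \<xi>))"
  then obtain f where f: "f \<in> schwartz"
    and eq: "\<And>\<phi>. \<phi> \<in> schwartz \<Longrightarrow> dist_of_fun (plane_wave k \<xi>) \<phi> = dist_of_fun f \<phi>"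
    unfolding is_schwartz_def by blast
  define \<psi> where "\<psi> = wave_packet (- k) (- \<xi>)"
  define \<psi>' where "\<psi>' n = (\<lambda>(t, x). \<psi> (t + 0, x + (- real n)))" for n
  have \<psi>: "\<psi> \<in> schwartz" unfolding \<psi>_def by (rule schwartz_wave_packet)
  have \<psi>': "\<psi>' n \<in> schwartz" for n unfolding \<psi>'_def by (rule schwartz_translate[OF \<psi>])
  define G where "G = (\<integral>x. exp (- (x::real)\<^sup>2) \<partial>lborel)"
  have "norm (dist_of_fun (plane_wave k \<xi>) (\<psi>' n)) = 2 * pi * G" for n
  proof -
    define c where "c = exp (\<i> * of_real \<xi> * of_real (real n))"
    have h: "plane_wave k \<xi> (t, x) * \<psi>' n (t, x) = c * of_real (exp (- (x - real n)\<^sup>2))" for t x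
    proof -
      have "plane_wave k \<xi> (t, x) = c * plane_wave k \<xi> (t, x - real n)"
        using plane_wave_add[of k \<xi> t "x - real n" "real n"] by (simp add: c_def)
      then show ?thesis
        using plane_wave_mult_inverse[of k \<xi> "(t, x - real n)"]
        by (simp add: \<psi>'_def \<psi>_def wave_packet_def)
    qed
    have inner: "(\<integral>x. plane_wave k \<xi> (t, x) * \<psi>' n (t, x) \<partial>lborel) = c * of_real G" for t
    proof -
      have "(\<integral>x. exp (- (x - real n)\<^sup>2) \<partial>lborel) = G"
        unfolding G_def by (subst lborel_integral_real_affine[of 1 _ "- real n"]) simp_all
      then show ?thesis unfolding h by simp
    qed
    have "dist_of_fun (plane_wave k \<xi>) (\<psi>' n) =
        (\<integral>t. indicator {0..2 * pi} t *\<^sub>R (\<integral>x. plane_wave k \<xi> (t, x) * \<psi>' n (t, x) \<partial>lborel) \<partial>lborel)"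
      unfolding dist_of_fun_def
    proof (rule strip_integral_tx)
      show "continuous_on UNIV (\<lambda>z. plane_wave k \<xi> z * \<psi>' n z)"
        by (intro continuous_intros continuous_on_plane_wave smooth_continuous_on schwartz_smooth \<psi>')
      show "norm (plane_wave k \<xi> (t, x) * \<psi>' n (t, x)) \<le> (1 * decay_const 0 0 (\<psi>' n)) * inverse (1
          + x\<^sup>2)" for t x
        using bounded_mult_schwartz_decay[of "plane_wave k \<xi>" 1 "\<psi>' n" t x 0 0, OF _ \<psi>'] by simp
    qed
    then show ?thesis
      using gaussian_integral_pos by (simp add: inner norm_mult c_def norm_exp_eq_Re flip: G_def)
  qed
  then have const: "norm (dist_of_fun f (\<psi>' n)) = 2 * pi * G" for n using eq[OF \<psi>'] by simp
  have "(\<lambda>n. dist_of_fun f (\<psi>' n)) \<longlonglongrightarrow> (LINT z:strip|lborel. 0)"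
    unfolding dist_of_fun_def set_lebesgue_integral_def
  proof (rule integral_dominated_convergence)
    let ?M = "schwartz_norm 0 0 0 \<psi>"
    have cf: "continuous_on UNIV f" by (rule smooth_continuous_on[OF schwartz_smooth[OF f]])
    have i: "set_integrable lborel strip f"
      by (rule strip_integrable[OF cf, of "decay_const 0 0 f"])
        (use schwartz_mixed_decay[OF f, of 0 0] in simp)
    show "integrable lborel (\<lambda>z. norm (indicator strip z *\<^sub>R f z) * ?M)"
      using i unfolding set_integrable_def by (intro integrable_mult_left integrable_norm)
    obtain B where "\<And>z. norm (f z) \<le> B" using bounded_C1_schwartz[OF f] unfolding bounded_C1_def
        by blast
    from dist_of_fun_integrable[OF cf this \<psi>']
    show "(\<lambda>z. indicator strip z *\<^sub>R (f z * \<psi>' n z)) \<in> borel_measurable lborel" for n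
      unfolding set_integrable_def by (rule borel_measurable_integrable)
    have M: "norm (\<psi>' n z) \<le> ?M" for n z
      using schwartz_mixed_bound[OF \<psi>, of "snd z - real n" 0 0 0 "fst z"]
          by (simp add: \<psi>'_def case_prod_beta)
    show "AE z in lborel. norm (indicator strip z *\<^sub>R (f z * \<psi>' n z))
        \<le> norm (indicator strip z *\<^sub>R f z) * ?M" for n
      using M by (intro AE_I2) (simp add: norm_mult mult.assoc mult_left_mono)
    show "AE z in lborel. (\<lambda>n. indicator strip z *\<^sub>R (f z * \<psi>' n z)) \<longlonglongrightarrow> indicator strip z *\<^sub>R 0"
    proof (rule AE_I2)
      fix z :: "real \<times> real"
      have "(\<lambda>n. \<psi>' n z) \<longlonglongrightarrow> 0"
      proof (rule Lim_null_comparison)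
        show "\<forall>\<^sub>F n in sequentially. norm (\<psi>' n z) \<le> decay_const 0 0 \<psi> * inverse (1
          + (snd z - real n)\<^sup>2)"
          using schwartz_mixed_decay[OF \<psi>, of 0 0 "fst z"] by (auto simp: \<psi>'_def case_prod_beta)
        have "filterlim (\<lambda>n. - snd z + real n) at_top sequentially"
          by (rule filterlim_tendsto_add_at_top[OF tendsto_const filterlim_real_sequentially])
        then have "filterlim (\<lambda>n. snd z - real n) at_bot sequentially"
          by (simp add: filterlim_uminus_at_bot)
        from filterlim_compose[OF tendsto_inverse_one_plus_square(2) this]
        show "(\<lambda>n. decay_const 0 0 \<psi> * inverse (1 + (snd z - real n)\<^sup>2)) \<longlonglongrightarrow> 0" .
      qed
      then have "(\<lambda>n. indicator strip z *\<^sub>R (f z * \<psi>' n z)) \<longlonglongrightarrow> indicator strip z *\<^sub>R (f z * 0)"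
        by (intro tendsto_intros)
      then show "(\<lambda>n. indicator strip z *\<^sub>R (f z * \<psi>' n z)) \<longlonglongrightarrow> indicator strip z *\<^sub>R 0" by simp
    qed
  qed simp
  then have "(\<lambda>n. norm (dist_of_fun f (\<psi>' n))) \<longlonglongrightarrow> 0"
    by (simp add: tendsto_norm_zero set_lebesgue_integral_def)
  then have "2 * pi * G = 0" unfolding const by (simp add: LIMSEQ_const_iff)
  then show False using gaussian_integral_pos by (simp add: G_def)
qed

lemma not_hypoelliptic_if_symbol_zero:
  assumes "\<i> * of_int k * ct + \<i> * of_real \<xi> * cx + q = 0"
  shows "\<not> schwartz_globally_hypoelliptic (first_order_op ct cx q)"
proof
  assume H: "schwartz_globally_hypoelliptic (first_order_op ct cx q)"
  let ?u = "dist_of_fun (plane_wave k \<xi>)"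
  have u: "?u \<in> tempered_distributions"
    by (rule dist_of_fun_tempered[OF continuous_on_plane_wave, of _ _ 1]) simp
  have z: "ct * (\<i> * of_int k * w) + cx * (\<i> * of_real \<xi> * w) + q * w = 0" for w
  proof -
    have "ct * (\<i> * of_int k * w) + cx * (\<i> * of_real \<xi> * w) + q * w =
        (\<i> * of_int k * ct + \<i> * of_real \<xi> * cx + q) * w" by (simp add: algebra_simps)
    then show ?thesis by (simp add: assms)
  qed
  have "first_order_op ct cx q ?u \<phi> = dist_of_fun (\<lambda>z. 0) \<phi>" if \<phi>: "\<phi> \<in> schwartz" for \<phi>
    unfolding first_order_op_tempered[OF u \<phi>] dist_of_fun_transpose[OF bounded_C1_plane_wave \<phi>] z ..
  then have "is_schwartz (first_order_op ct cx q ?u)"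
    unfolding is_schwartz_def using schwartz_zero by blast
  then show False
    using H u plane_wave_not_schwartz unfolding schwartz_globally_hypoelliptic_def by blast
qed

section \<open>The characterisation\<close>

text \<open>A number outside the integers keeps a positive distance from all of them; this turns the
  arithmetic conditions of the theorem into bounds that are uniform in \<open>k\<close>.\<close>

lemma dist_Ints_pos:
  fixes r :: real
  assumes "r \<notin> \<int>"
  shows "\<exists>d>0. \<forall>k::int. d \<le> \<bar>r + of_int k\<bar>"
proof (intro exI conjI allI)
  show "0 < min (frac r) (1 - frac r)"
    using assms by (simp add: frac_lt_1)
  fix k :: int
  have r: "r = of_int \<lfloor>r\<rfloor> + frac r" by (simp add: frac_def)
  have "\<lfloor>r\<rfloor> + k \<ge> 0 \<or> \<lfloor>r\<rfloor> + k \<le> -1" by linarith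
  then show "min (frac r) (1 - frac r) \<le> \<bar>r + of_int k\<bar>"
  proof
    assume "\<lfloor>r\<rfloor> + k \<ge> 0"
    then have "0 \<le> (of_int (\<lfloor>r\<rfloor> + k) :: real)" by (simp only: of_int_0_le_iff)
    then show ?thesis using r frac_ge_0[of r] by simp
  next
    assume "\<lfloor>r\<rfloor> + k \<le> -1"
    then have "(of_int (\<lfloor>r\<rfloor> + k) :: real) \<le> of_int (-1)" by (simp only: of_int_le_iff)
    then show ?thesis using r frac_lt_1[of r] by simp
  qed
qed

text \<open>For \<open>c = a + i b\<close> and \<open>b \<noteq> 0\<close>, the number \<open>Re \<mu>\<^sub>k\<close> is
  \<open>b (a Re q / b + Im q + k) / \<bar>c\<bar>\<^sup>2\<close> in the first family, and it is \<open>Re q - k b\<close> in the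
  second family for every \<open>b\<close>. Where it vanishes for some \<open>k\<close>, the corresponding real
  frequency \<open>\<xi>\<close> is \<open>- Im \<mu>\<^sub>k\<close>.\<close>

theorem corollary3p2:
  fixes a b :: real and q :: complex
  shows "(schwartz_globally_hypoelliptic
            (first_order_op 1 (complex_of_real a + \<i> * complex_of_real b) q) \<longleftrightarrow>
          (b \<noteq> 0 \<and> a * (Re q / b) + Im q \<notin> \<int>) \<or>
          (b = 0 \<and> Re q \<noteq> 0) \<or>
          (b = 0 \<and> Re q = 0 \<and> a = 0 \<and> Im q \<notin> \<int>)) \<and>
         (schwartz_globally_hypoelliptic
            (first_order_op (complex_of_real a + \<i> * complex_of_real b) 1 q) \<longleftrightarrow>
          (b \<noteq> 0 \<and> Re q / b \<notin> \<int>) \<or>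
          (b = 0 \<and> Re q \<noteq> 0))"
proof -
  define c where "c = complex_of_real a + \<i> * complex_of_real b"
  have Rec: "Re c = a" "Im c = b" by (simp_all add: c_def)
  have c0: "c = 0 \<longleftrightarrow> a = 0 \<and> b = 0" by (auto simp: complex_eq_iff Rec)
  have yes1: "schwartz_globally_hypoelliptic (first_order_op 1 c q)"
    if cond: "(b \<noteq> 0 \<and> a * (Re q / b) + Im q \<notin> \<int>) \<or> (b = 0 \<and> Re q \<noteq> 0) \<or>
      (b = 0 \<and> Re q = 0 \<and> a = 0 \<and> Im q \<notin> \<int>)"
  proof (cases "c = 0")
    case False
    have s: "a\<^sup>2 + b\<^sup>2 > 0" using False c0 by (simp add: sum_power2_gt_zero_iff)
    have Re: "Re ((\<i> * of_int k * 1 + q) / c) = (a * Re q + b * (Im q + of_int k)) / (a\<^sup>2 + b\<^sup>2)"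
        for k
      by (simp add: Re_divide Rec algebra_simps)
    show ?thesis
    proof (cases "b = 0")
      case True
      then have "Re q \<noteq> 0" "a \<noteq> 0" using cond False c0 by auto
      then show ?thesis
        by (intro hypoelliptic_if_modes_hyperbolic[OF False, of "\<bar>Re q / a\<bar>"])
          (use Re True in \<open>auto simp: power2_eq_square abs_divide abs_mult\<close>)
    next
      case b: False
      then obtain d where d: "0 < d" "\<And>k::int. d \<le> \<bar>a * (Re q / b) + Im q + of_int k\<bar>"
        using dist_Ints_pos cond by blast
      have e: "a * Re q + b * (Im q + of_int k) = b * (a * (Re q / b) + Im q + of_int k)"
          for k :: int
        using b by (simp add: field_simps)
      show ?thesis
      proof (rule hypoelliptic_if_modes_hyperbolic[OF False])
        show "0 < \<bar>b\<bar> * d / (a\<^sup>2 + b\<^sup>2)" using b d s by simp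
        show "\<bar>b\<bar> * d / (a\<^sup>2 + b\<^sup>2) \<le> \<bar>Re ((\<i> * of_int k * 1 + q) / c)\<bar>" for k
          unfolding Re e abs_divide abs_mult using s d(2)[of k]
          by (simp add: divide_right_mono mult_left_mono)
      qed
    qed
  next
    case True
    then have ab: "a = 0" "b = 0" using c0 by auto
    show ?thesis
    proof (cases "Re q = 0")
      case False
      then show ?thesis
        unfolding True
        by (intro hypoelliptic_without_x_derivative[of "\<bar>Re q\<bar>"]) (auto intro: order_trans[OF _ abs_Re_le_cmod])
    next
      case q: True
      then obtain d where d: "0 < d" "\<And>k::int. d \<le> \<bar>Im q + of_int k\<bar>"
        using dist_Ints_pos cond ab by blast
      have "d \<le> norm (\<i> * of_int k * 1 + q)" for k :: int
        using d(2)[of k] abs_Im_le_cmod[of "\<i> * of_int k * 1 + q"] by (simp add: add.commute)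
      then show ?thesis
        unfolding True using d(1) by (intro hypoelliptic_without_x_derivative[of d]) auto
    qed
  qed
  have no1: "\<not> schwartz_globally_hypoelliptic (first_order_op 1 c q)"
    if cond: "\<not> ((b \<noteq> 0 \<and> a * (Re q / b) + Im q \<notin> \<int>) \<or> (b = 0 \<and> Re q \<noteq> 0) \<or>
      (b = 0 \<and> Re q = 0 \<and> a = 0 \<and> Im q \<notin> \<int>))"
  proof -
    have "\<exists>k \<xi>. \<i> * of_int k * 1 + \<i> * of_real \<xi> * c + q = 0"
    proof (cases "b = 0")
      case False
      then obtain m where m: "a * (Re q / b) + Im q = of_int m" using cond
          by (auto elim: Ints_cases)
      have "\<i> * of_int (- m) * 1 + \<i> * of_real (Re q / b) * c + q = 0"
        using False m by (simp add: complex_eq_iff Rec field_simps)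
      then show ?thesis by blast
    next
      case b: True
      show ?thesis
      proof (cases "a = 0")
        case True
        then obtain m where m: "Im q = of_int m" using cond b by (auto elim: Ints_cases)
        have "\<i> * of_int (- m) * 1 + \<i> * of_real 0 * c + q = 0"
          using cond b m by (simp add: complex_eq_iff)
        then show ?thesis by blast
      next
        case False
        have "\<i> * of_int 0 * 1 + \<i> * of_real (- Im q / a) * c + q = 0"
          using cond b False by (simp add: complex_eq_iff Rec)
        then show ?thesis by blast
      qed
    qed
    then show ?thesis using not_hypoelliptic_if_symbol_zero by blast
  qed
  have yes2: "schwartz_globally_hypoelliptic (first_order_op c 1 q)"
    if cond: "(b \<noteq> 0 \<and> Re q / b \<notin> \<int>) \<or> (b = 0 \<and> Re q \<noteq> 0)"
  proof -
    have Re: "Re ((\<i> * of_int k * c + q) / 1) = Re q - of_int k * b" for k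
      by (simp add: Rec)
    show ?thesis
    proof (cases "b = 0")
      case True
      then show ?thesis
        using cond by (intro hypoelliptic_if_modes_hyperbolic[of _ "\<bar>Re q\<bar>"]) (auto simp: Rec)
    next
      case b: False
      then obtain d where d: "0 < d" "\<And>k::int. d \<le> \<bar>Re q / b + of_int k\<bar>"
        using dist_Ints_pos cond by blast
      have e: "Re q - of_int k * b = b * (Re q / b + of_int (- k))" for k :: int
        using b by (simp add: field_simps)
      show ?thesis
      proof (rule hypoelliptic_if_modes_hyperbolic)
        show "0 < \<bar>b\<bar> * d" using b d by simp
        show "\<bar>b\<bar> * d \<le> \<bar>Re ((\<i> * of_int k * c + q) / 1)\<bar>" for k
          unfolding Re e abs_mult using d(2)[of "- k"] by (simp add: mult_left_mono)
      qed simp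
    qed
  qed
  have no2: "\<not> schwartz_globally_hypoelliptic (first_order_op c 1 q)"
    if cond: "\<not> ((b \<noteq> 0 \<and> Re q / b \<notin> \<int>) \<or> (b = 0 \<and> Re q \<noteq> 0))"
  proof -
    obtain m where m: "Re q = of_int m * b"
    proof (cases "b = 0")
      case True
      then show ?thesis using that[of 0] cond by simp
    next
      case False
      then obtain m where "Re q / b = of_int m" using cond by (auto elim: Ints_cases)
      then show ?thesis using that[of m] False by (simp add: field_simps)
    qed
    have "\<i> * of_int m * c + \<i> * of_real (- (a * of_int m + Im q)) * 1 + q = 0"
      using m by (simp add: complex_eq_iff Rec)
    then show ?thesis by (rule not_hypoelliptic_if_symbol_zero)
  qed
  show ?thesis
    using yes1 no1 yes2 no2 unfolding c_def by blast
qed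

end
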